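(* Let $\Sigma$ be a finite alphabet of size $\sigma\ge 2$ (not necessarily constant). There is an algorithm (called $\textsf{Wp}$) which, given an arbitrary pattern $x$ of length $m$ over $\Sigma\cup\{\phi\}$ containing exactly $g$ wildcards $\phi$, where $$\frac{g}{m}<\frac12-\frac{3\log_\sigma m}{m},$$ and a text $t$ of length $n>m$ drawn uniformly at random over $\Sigma$, finds all $i$ such that $t[i..i+m-1]$ matches $x$, with average-case search time $O\!\left(\frac{n(g+\log_\sigma m)}{m}\right)$, preprocessing time $O(m^4)$ and space $O(m^4)$.
   Context: The wildcard $\phi\notin\Sigma$ matches itself and every letter of $\Sigma$: two characters $a,b\in\Sigma\cup\{\phi\}$ correspond, $a\approx^{\phi} b$, if they are equal or at least one of them is $\phi$; two strings of equal length match if they correspond at every position. Strings are indexed from $0$. Problem (Wildcards in the Pattern): given a text $t$ of length $n$ over $\Sigma$ and a pattern $x$ of length $m$ over $\Sigma\cup\{\phi\}$, find all $i$ with $t[i..i+m-1]\approx^{\phi} x[0..m-1]$. Model: word RAM with word size $\Omega(\log n)$. The pattern is arbitrary (not random). The text is random, its characters being independent and uniform over $\Sigma$. The average-case search time is the expected running time over the random text, for an arbitrary (worst-case) pattern with $g$ wildcards, not counting the time spent preprocessing the pattern. Preprocessing depends only on the pattern and the alphabet.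
   Formalization: In the search-time bound, log_σ m is read as max(1, log_σ m); literally the bound fails for g = 0, e.g. it is 0 at m = 1 although the text must be read; for g ≥ 1 or σ ≤ m both forms agree up to a factor 2. *)

theory Defs
  imports "HOL-Probability.Probability"
begin

section \<open>Strings with wildcards\<close>

text \<open>
  A character of \<open>\<Sigma> \<union> {\<phi>}\<close> is an option value, \<open>None\<close> being the wildcard \<open>\<phi>\<close>.
\<close>

definition corr :: "'a option \<Rightarrow> 'a option \<Rightarrow> bool" where
  "corr a b \<longleftrightarrow> a = b \<or> a = None \<or> b = None"

definition matches :: "'a option list \<Rightarrow> 'a option list \<Rightarrow> bool" where
  "matches u v \<longleftrightarrow> length u = length v \<and> (\<forall>j<length u. corr (u ! j) (v ! j))"

definition occurrences :: "'a option list \<Rightarrow> 'a list \<Rightarrow> nat set" where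
  "occurrences x t =
     {i. i + length x \<le> length t \<and> matches (map Some (take (length x) (drop i t))) x}"


section \<open>The word RAM\<close>

text \<open>
  A machine with word size \<open>w\<close> computes with numbers below \<open>2 ^ w\<close> at unit cost. It has
  registers (a program mentions only finitely many of them), a random-access memory of \<open>S\<close>
  words, a read-only input tape \<open>t\<close> with random access, holding one letter per word, and a
  write-only output. Programs are structured, and constants in them are truncated to \<open>w\<close> bits,
  so that one program serves all word sizes.
\<close>

datatype binop =
  Plus | Minus | Times | Divide | Modulo | BitAnd | BitOr | BitXor | ShiftL | ShiftR | Less | Equal

datatype exp =
    Const nat
  | Reg nat
  | Mem exp
  | Txt exp
  | Bin binop exp exp

datatype com =
    Skip
  | Assign nat exp
  | Store exp exp
  | Output exp
  | Seq com com
  | Cond exp com com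
  | While exp com

record state =
  regs :: "nat \<Rightarrow> nat"
  mem :: "nat \<Rightarrow> nat"
  out :: "nat list"

fun binop_val :: "nat \<Rightarrow> binop \<Rightarrow> nat \<Rightarrow> nat \<Rightarrow> nat" where
  "binop_val w Plus a b = (a + b) mod 2 ^ w"
| "binop_val w Minus a b = (a + 2 ^ w - b) mod 2 ^ w"
| "binop_val w Times a b = (a * b) mod 2 ^ w"
| "binop_val w Divide a b = a div b"
| "binop_val w Modulo a b = a mod b"
| "binop_val w BitAnd a b = Bit_Operations.and a b"
| "binop_val w BitOr a b = Bit_Operations.or a b"
| "binop_val w BitXor a b = Bit_Operations.xor a b"
| "binop_val w ShiftL a b = push_bit b a mod 2 ^ w"
| "binop_val w ShiftR a b = drop_bit b a"
| "binop_val w Less a b = (if a < b then 1 else 0) mod 2 ^ w"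
| "binop_val w Equal a b = (if a = b then 1 else 0) mod 2 ^ w"

fun eval :: "nat \<Rightarrow> nat list \<Rightarrow> state \<Rightarrow> exp \<Rightarrow> nat" where
  "eval w t s (Const k) = k mod 2 ^ w"
| "eval w t s (Reg r) = regs s r"
| "eval w t s (Mem a) = mem s (eval w t s a)"
| "eval w t s (Txt a) = t ! eval w t s a"
| "eval w t s (Bin f a b) = binop_val w f (eval w t s a) (eval w t s b)"

text \<open>
  All addresses read lie within the memory of size \<open>S\<close> and within the input tape,
  respectively. A program that violates this is stuck (there is no run).
\<close>

fun safe :: "nat \<Rightarrow> nat \<Rightarrow> nat list \<Rightarrow> state \<Rightarrow> exp \<Rightarrow> bool" where
  "safe S w t s (Const k) = True"
| "safe S w t s (Reg r) = True"
| "safe S w t s (Mem a) = (safe S w t s a \<and> eval w t s a < S)"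
| "safe S w t s (Txt a) = (safe S w t s a \<and> eval w t s a < length t)"
| "safe S w t s (Bin f a b) = (safe S w t s a \<and> safe S w t s b)"

fun cost :: "exp \<Rightarrow> nat" where
  "cost (Const k) = 1"
| "cost (Reg r) = 1"
| "cost (Mem a) = 1 + cost a"
| "cost (Txt a) = 1 + cost a"
| "cost (Bin f a b) = 1 + cost a + cost b"

text \<open>
  \<open>exec S w t c s k s'\<close>: with \<open>S\<close> words of memory, word size \<open>w\<close> and input tape \<open>t\<close>,
  the program \<open>c\<close> started in \<open>s\<close> halts in \<open>s'\<close> after exactly \<open>k\<close> steps.
\<close>

inductive exec :: "nat \<Rightarrow> nat \<Rightarrow> nat list \<Rightarrow> com \<Rightarrow> state \<Rightarrow> nat \<Rightarrow> state \<Rightarrow> bool"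
  for S w :: nat and t :: "nat list" where
  Skip: "exec S w t Skip s 1 s"
| Assign: "safe S w t s e \<Longrightarrow>
    exec S w t (Assign r e) s (1 + cost e) (s\<lparr>regs := (regs s)(r := eval w t s e)\<rparr>)"
| Store: "safe S w t s a \<Longrightarrow> safe S w t s e \<Longrightarrow> eval w t s a < S \<Longrightarrow>
    exec S w t (Store a e) s (1 + cost a + cost e)
      (s\<lparr>mem := (mem s)(eval w t s a := eval w t s e)\<rparr>)"
| Output: "safe S w t s e \<Longrightarrow>
    exec S w t (Output e) s (1 + cost e) (s\<lparr>out := out s @ [eval w t s e]\<rparr>)"
| Seq: "exec S w t c1 s k1 s' \<Longrightarrow> exec S w t c2 s' k2 s'' \<Longrightarrow>
    exec S w t (Seq c1 c2) s (k1 + k2) s''"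
| CondTrue: "safe S w t s e \<Longrightarrow> eval w t s e \<noteq> 0 \<Longrightarrow> exec S w t c1 s k s' \<Longrightarrow>
    exec S w t (Cond e c1 c2) s (1 + cost e + k) s'"
| CondFalse: "safe S w t s e \<Longrightarrow> eval w t s e = 0 \<Longrightarrow> exec S w t c2 s k s' \<Longrightarrow>
    exec S w t (Cond e c1 c2) s (1 + cost e + k) s'"
| WhileFalse: "safe S w t s e \<Longrightarrow> eval w t s e = 0 \<Longrightarrow>
    exec S w t (While e c) s (1 + cost e) s"
| WhileTrue: "safe S w t s e \<Longrightarrow> eval w t s e \<noteq> 0 \<Longrightarrow> exec S w t c s k s' \<Longrightarrow>
    exec S w t (While e c) s' k' s'' \<Longrightarrow>
    exec S w t (While e c) s (1 + cost e + k + k') s''"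

inductive_cases exec_SkipE: "exec S w t Skip s k s'"
inductive_cases exec_AssignE: "exec S w t (Assign r e) s k s'"
inductive_cases exec_StoreE: "exec S w t (Store a e) s k s'"
inductive_cases exec_OutputE: "exec S w t (Output e) s k s'"
inductive_cases exec_SeqE: "exec S w t (Seq c1 c2) s k s'"
inductive_cases exec_CondE: "exec S w t (Cond e c1 c2) s k s'"
inductive_cases exec_WhileE: "exec S w t (While e c) s k s'"

text \<open>Runs are deterministic, so the number of steps is a function of program and input.\<close>

lemma exec_deterministic:
  assumes "exec S w t c s k s'" and "exec S w t c s k1 s1"
  shows "k1 = k \<and> s1 = s'"
  using assms
proof (induction arbitrary: k1 s1 rule: exec.induct)
  case Skip
  then show ?case by (auto elim: exec_SkipE)
next
  case Assign
  from Assign.prems show ?case by (auto elim: exec_AssignE)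
next
  case Store
  from Store.prems show ?case by (auto elim: exec_StoreE)
next
  case Output
  from Output.prems show ?case by (auto elim: exec_OutputE)
next
  case (Seq c1 s ka sa c2 kb sb)
  from Seq.prems obtain k' k'' s' where
    *: "k1 = k' + k''" "exec S w t c1 s k' s'" "exec S w t c2 s' k'' s1"
    by (rule exec_SeqE)
  from Seq.IH(1)[OF *(2)] have **: "k' = ka" "s' = sa" by simp_all
  from Seq.IH(2)[of k'' s1] *(3) ** have "k'' = kb \<and> s1 = sb" by simp
  with *(1) ** show ?case by simp
next
  case (CondTrue s e c1 k s' c2)
  from CondTrue.prems obtain k' where
    *: "k1 = 1 + cost e + k'" "exec S w t c1 s k' s1"
    by (rule exec_CondE) (use CondTrue.hyps(2) in auto)
  from CondTrue.IH[OF *(2)] *(1) show ?case by simp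
next
  case (CondFalse s e c2 k s' c1)
  from CondFalse.prems obtain k' where
    *: "k1 = 1 + cost e + k'" "exec S w t c2 s k' s1"
    by (rule exec_CondE) (use CondFalse.hyps(2) in auto)
  from CondFalse.IH[OF *(2)] *(1) show ?case by simp
next
  case (WhileFalse s e c)
  from WhileFalse.prems show ?case
    by (rule exec_WhileE) (use WhileFalse.hyps(2) in auto)
next
  case (WhileTrue s e c ka sa kb sb)
  from WhileTrue.prems obtain k' k'' s' where
    *: "k1 = 1 + cost e + k' + k''" "exec S w t c s k' s'" "exec S w t (While e c) s' k'' s1"
    by (rule exec_WhileE) (use WhileTrue.hyps(2) in auto)
  from WhileTrue.IH(1)[OF *(2)] have **: "k' = ka" "s' = sa" by simp_all
  from WhileTrue.IH(2)[of k'' s1] *(3) ** have "k'' = kb \<and> s1 = sb" by simp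
  with *(1) ** show ?case by simp
qed


section \<open>Input conventions\<close>

text \<open>
  The letters are the numbers below \<open>\<sigma>\<close>, and in memory \<open>\<sigma>\<close> itself encodes the wildcard.
  Preprocessing starts with \<open>\<sigma>\<close> in register 0, the length of the pattern in register 1, and
  the pattern in the first memory cells. The search starts where the preprocessing has ended,
  with the length of the text in register 2 and an empty output.
\<close>

definition pattern_start :: "nat \<Rightarrow> nat option list \<Rightarrow> state" where
  "pattern_start \<sigma> x =
     \<lparr>regs = (\<lambda>r. if r = 0 then \<sigma> else if r = 1 then length x else 0),
      mem = (\<lambda>i. if i < length x then (case x ! i of Some a \<Rightarrow> a | None \<Rightarrow> \<sigma>) else 0),
      out = []\<rparr>"

definition search_start :: "nat \<Rightarrow> state \<Rightarrow> state" where
  "search_start n s = s\<lparr>regs := (regs s)(2 := n), out := []\<rparr>"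

definition random_text :: "nat \<Rightarrow> nat \<Rightarrow> nat list pmf" where
  "random_text \<sigma> n = replicate_pmf n (pmf_of_set {..<\<sigma>})"

text \<open>
  A search has to read a letter in each of the disjoint length-\<open>m\<close> blocks of the text, so no
  bound below order \<open>n / m\<close> is possible. Time bounds therefore read \<open>log\<^sub>\<sigma> m\<close> as
  \<open>max 1 (log\<^sub>\<sigma> m)\<close>. This makes a difference beyond a factor 2 only if \<open>g = 0\<close> and
  \<open>m < \<sigma>\<close>:
\<close>

lemma wildcards_plus_log_bound:
  fixes g m \<sigma> :: nat
  assumes "\<sigma> \<ge> 2" and "m \<ge> 1" and "g \<ge> 1 \<or> \<sigma> \<le> m"
  shows "real g + max 1 (log (real \<sigma>) (real m)) \<le> 2 * (real g + log (real \<sigma>) (real m))"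
proof -
  have "log (real \<sigma>) (real m) \<ge> 0"
    using assms by (intro zero_le_log_cancel_iff[THEN iffD2]) auto
  moreover have "log (real \<sigma>) (real m) \<ge> 1" if "\<sigma> \<le> m"
    using assms that by (subst one_le_log_cancel_iff) auto
  ultimately show ?thesis using assms(3) by (auto simp: max_def)
qed

end

theory Submission
  imports Defs
begin

text \<open>
  Let \<open>M = min \<sigma> m\<close>, reduce letters modulo \<open>M\<close>, and let \<open>l \<approx> max 1 (log\<^sub>\<sigma> m)\<close> be such that
  \<open>m \<le> M\<^sup>l \<le> m\<^sup>2\<close>. Every window of length \<open>m\<close> contains exactly one of the text blocks
  \<open>[a, a + l)\<close> with \<open>a\<close> a multiple of \<open>s = m - l + 1\<close>, so it suffices to read these blocks and to
  look up, in a table indexed by the \<open>M\<^sup>l\<close> reduced blocks, all offsets \<open>j\<close> in the pattern at which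
  the block fits. An offset whose \<open>l\<close> letters include \<open>k\<close> wildcards fits with probability at most
  \<open>\<rho>\<^bsup>l-k\<^esup>\<close>, where \<open>\<rho>\<^sup>l = O(1/m)\<close>. By convexity this is at most \<open>\<rho>\<^sup>l + k/l\<close>, and every wildcard is
  seen by at most \<open>l\<close> offsets, so the expected number of candidates per block is at most \<open>g + 2\<close>.
  A candidate is verified at the remaining non-wildcard positions, in an order tabulated for each
  offset. These letters are independent of the block, so \<open>O(1)\<close> comparisons are expected. With
  \<open>O(n/m)\<close> blocks the total is \<open>O(n (l + g) / m)\<close>.
\<close>

section \<open>Weakest preconditions for timed runs\<close>

text \<open>Total correctness with time. As runs are deterministic, asking for some run with
  \<open>Q\<close> describes the only run, so the rules below can be equivalences.\<close>

definition wp :: "nat \<Rightarrow> nat \<Rightarrow> nat list \<Rightarrow> com \<Rightarrow> (nat \<Rightarrow> state \<Rightarrow> bool) \<Rightarrow> state \<Rightarrow> bool" where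
  "wp S w t c Q s \<longleftrightarrow> (\<exists>k s'. exec S w t c s k s' \<and> Q k s')"

lemma wp_mono:
  assumes "wp S w t c P s" and "\<And>k s'. P k s' \<Longrightarrow> Q k s'"
  shows "wp S w t c Q s"
  using assms unfolding wp_def by blast

lemma wp_det: "exec S w t c s k s' \<Longrightarrow> wp S w t c Q s \<longleftrightarrow> Q k s'"
  unfolding wp_def using exec_deterministic by blast

lemma wp_Skip [simp]: "wp S w t Skip Q s \<longleftrightarrow> Q 1 s"
  by (rule wp_det) (rule exec.Skip)

lemma wp_Assign [simp]:
  "wp S w t (Assign r e) Q s \<longleftrightarrow>
     safe S w t s e \<and> Q (1 + cost e) (s\<lparr>regs := (regs s)(r := eval w t s e)\<rparr>)"
proof (cases "safe S w t s e")
  case True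
  show ?thesis using wp_det[OF exec.Assign[OF True]] True by metis
qed (auto simp: wp_def elim: exec_AssignE)

lemma wp_Store [simp]:
  "wp S w t (Store a e) Q s \<longleftrightarrow>
     safe S w t s a \<and> safe S w t s e \<and> eval w t s a < S \<and>
     Q (1 + cost a + cost e) (s\<lparr>mem := (mem s)(eval w t s a := eval w t s e)\<rparr>)"
proof (cases "safe S w t s a \<and> safe S w t s e \<and> eval w t s a < S")
  case True
  then show ?thesis using wp_det[OF exec.Store[of S w t s a e]] by metis
qed (auto simp: wp_def elim: exec_StoreE)

lemma wp_Output [simp]:
  "wp S w t (Output e) Q s \<longleftrightarrow>
     safe S w t s e \<and> Q (1 + cost e) (s\<lparr>out := out s @ [eval w t s e]\<rparr>)"
proof (cases "safe S w t s e")
  case True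
  show ?thesis using wp_det[OF exec.Output[OF True]] True by metis
qed (auto simp: wp_def elim: exec_OutputE)

lemma wp_Seq [simp]:
  "wp S w t (Seq c1 c2) Q s \<longleftrightarrow> wp S w t c1 (\<lambda>k. wp S w t c2 (\<lambda>k'. Q (k + k'))) s"
  unfolding wp_def
proof (safe elim!: exec_SeqE, goal_cases)
  case (2 k s' k' s'')
  then show ?case by (blast intro: exec.Seq)
qed blast

lemma wp_Cond [simp]:
  "wp S w t (Cond e c1 c2) Q s \<longleftrightarrow>
     safe S w t s e \<and>
     (if eval w t s e \<noteq> 0 then wp S w t c1 (\<lambda>k. Q (1 + cost e + k)) s
      else wp S w t c2 (\<lambda>k. Q (1 + cost e + k)) s)"
    (is "?L \<longleftrightarrow> ?R")
proof
  assume ?L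
  then obtain k s' where "exec S w t (Cond e c1 c2) s k s'" and Q: "Q k s'"
    unfolding wp_def by blast
  from this(1) show ?R
    by (rule exec_CondE) (use Q in \<open>auto simp: wp_def\<close>)
next
  assume R: ?R
  show ?L
  proof (cases "eval w t s e = 0")
    case True
    with R obtain k s' where "exec S w t c2 s k s'" "Q (1 + cost e + k) s'"
      unfolding wp_def by auto
    with R True exec.CondFalse[of S w t s e c2 k s' c1] show ?thesis unfolding wp_def by blast
  next
    case False
    with R obtain k s' where "exec S w t c1 s k s'" "Q (1 + cost e + k) s'"
      unfolding wp_def by auto
    with R False exec.CondTrue[of S w t s e c1 k s' c2] show ?thesis unfolding wp_def by blast
  qed
qed

text \<open>The number \<open>N\<close> of rounds is known beforehand and the invariant is indexed
  by the round, so one induction yields termination, result and total cost. The terms outside the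
  sum pay for the last, failing test.\<close>

lemma wp_While:
  assumes "I 0 s"
    and "\<And>i s. i < N \<Longrightarrow> I i s \<Longrightarrow>
           safe S w t s e \<and> eval w t s e \<noteq> 0 \<and> wp S w t c (\<lambda>k s'. k \<le> b i \<and> I (Suc i) s') s"
    and "\<And>s. I N s \<Longrightarrow> safe S w t s e \<and> eval w t s e = 0"
  shows "wp S w t (While e c) (\<lambda>k s'. k \<le> (\<Sum>i<N. b i + cost e + 1) + cost e + 1 \<and> I N s') s"
  using assms
proof (induction N arbitrary: I s b)
  case 0
  then have "exec S w t (While e c) s (1 + cost e) s" by (intro exec.WhileFalse) auto
  with 0 show ?case unfolding wp_def by auto
next
  case (Suc N)
  from Suc.prems(2)[OF _ Suc.prems(1)] obtain k s1 where
    1: "safe S w t s e" "eval w t s e \<noteq> 0" "exec S w t c s k s1" "k \<le> b 0" "I 1 s1"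
    unfolding wp_def by auto
  \<comment> \<open>With the first round peeled off, invariant and cost bound are shifted by
    one.\<close>
  have "wp S w t (While e c)
      (\<lambda>k s'. k \<le> (\<Sum>i<N. b (Suc i) + cost e + 1) + cost e + 1 \<and> I (Suc N) s') s1"
    by (rule Suc.IH[of "\<lambda>i. I (Suc i)" s1 "\<lambda>i. b (Suc i)"]) (use 1 Suc.prems(2,3) in auto)
  then obtain k' s2 where
    2: "exec S w t (While e c) s1 k' s2"
       "k' \<le> (\<Sum>i<N. b (Suc i) + cost e + 1) + cost e + 1" "I (Suc N) s2"
    unfolding wp_def by blast
  have "exec S w t (While e c) s (1 + cost e + k + k') s2"
    by (rule exec.WhileTrue[OF 1(1-3) 2(1)])
  moreover have "1 + cost e + k + k' \<le> (\<Sum>i<Suc N. b i + cost e + 1) + cost e + 1"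
    using 1(4) 2(2) by (subst sum.lessThan_Suc_shift) simp
  ultimately show ?case using 2(3) unfolding wp_def by blast
qed

section \<open>Word arithmetic without overflow\<close>

lemma truth_mod [simp]:
  "w > 0 \<Longrightarrow> (if P then 1 else 0) mod 2 ^ w = (if P then 1 else 0 :: nat)"
  by (cases P) (auto simp: mod_less)

lemma word_minus [simp]:
  assumes "b \<le> a" and "a < 2 ^ w"
  shows "(a + 2 ^ w - b) mod 2 ^ w = (a - b :: nat)"
proof -
  have "a + 2 ^ w - b = (a - b) + 2 ^ w" using assms(1) by (rule Nat.diff_add_assoc2)
  moreover have "a - b < 2 ^ w" using assms(2) by (rule less_imp_diff_less)
  ultimately show ?thesis by (simp only: mod_add_self2 mod_less)
qed

section \<open>Filling tables\<close>

definition has_row :: "(nat \<Rightarrow> nat) \<Rightarrow> nat \<Rightarrow> nat \<Rightarrow> nat list \<Rightarrow> bool" where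
  "has_row \<mu> W q l \<longleftrightarrow> (\<forall>c<W. \<mu> (W * q + c) = (if c < length l then l ! c else 0))"

lemma has_row_snoc:
  "has_row \<mu> W q l \<Longrightarrow> has_row (\<mu>(W * q + length l := v)) W q (l @ [v])"
  unfolding has_row_def by (auto simp: nth_append)

lemma has_row_cong:
  "has_row \<mu> W q l \<Longrightarrow> (\<And>c. c < W \<Longrightarrow> \<mu>' (W * q + c) = \<mu> (W * q + c)) \<Longrightarrow> has_row \<mu>' W q l"
  unfolding has_row_def by auto

text \<open>Registers below 8 keep their values while tables are filled and texts are searched;
  those from 8 on are scratch space.\<close>

abbreviation "RS \<equiv> Reg 0"
abbreviation "Rm \<equiv> Reg 1"
abbreviation "Rn \<equiv> Reg 2"
abbreviation "RM \<equiv> Reg 3"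
abbreviation "Rl \<equiv> Reg 4"
abbreviation "RK \<equiv> Reg 5"
abbreviation "Rs \<equiv> Reg 6"

definition row_start :: "exp \<Rightarrow> exp \<Rightarrow> exp" where
  "row_start b i = Bin Times (Bin Plus Rm (Const 1)) (Bin Plus b i)"

text \<open>The command \<open>classify\<close> decides whether the element with index \<open>Reg 9\<close> belongs to the row
  \<open>Reg 8\<close> (flag in \<open>Reg 11\<close>), and computes its entry (\<open>Reg 12\<close>).\<close>

definition fill :: "com \<Rightarrow> com" where
  "fill classify =
     While (Bin Less (Reg 9) Rs)
      (Seq classify
      (Seq (Cond (Reg 11) (Seq (Store (Reg 10) (Reg 12)) (Assign 10 (Bin Plus (Reg 10) (Const 1)))) Skip)
           (Assign 9 (Bin Plus (Reg 9) (Const 1)))))"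

definition table :: "com \<Rightarrow> exp \<Rightarrow> exp \<Rightarrow> com" where
  "table classify b e =
     Seq (Assign 8 (Const 0))
      (While (Bin Less (Reg 8) e)
        (Seq (Assign 9 (Const 0))
        (Seq (Assign 10 (row_start b (Reg 8)))
        (Seq (fill classify)
             (Assign 8 (Bin Plus (Reg 8) (Const 1)))))))"

text \<open>What the table commands must preserve: the parameter registers and the pattern, which
  occupies the first \<open>R 1\<close> cells.\<close>

definition env :: "(nat \<Rightarrow> nat) \<Rightarrow> (nat \<Rightarrow> nat) \<Rightarrow> state \<Rightarrow> bool" where
  "env R \<mu> s \<longleftrightarrow> (\<forall>r<8. regs s r = R r) \<and> (\<forall>a<R 1. mem s a = \<mu> a)"

text \<open>Abstracting from the membership test lets the probe table and the candidate table share
  one verified loop.\<close>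

definition classify_ok where
  "classify_ok S w t classify b R \<mu> q P f \<longleftrightarrow> (\<forall>s i. env R \<mu> s \<longrightarrow> regs s 8 = q \<longrightarrow> regs s 9 = i \<longrightarrow> i < R 6 \<longrightarrow>
      wp S w t classify (\<lambda>k s'. k \<le> b \<and> mem s' = mem s \<and> (\<forall>r<11. regs s' r = regs s r) \<and>
        regs s' 11 = (if P i then 1 else 0) \<and> regs s' 12 = f i) s)"

lemma wp_fill:
  assumes classify: "classify_ok S w t classify b R \<mu> q P f"
    and s0: "env R \<mu> s0" "regs s0 8 = q" "regs s0 9 = 0" "regs s0 10 = W * p"
      "\<And>c. c < W \<Longrightarrow> mem s0 (W * p + c) = 0"
    and W: "W = R 1 + 1" "p > 0" "R 6 \<le> R 1" "W * p + W \<le> S" "W * p + W < 2 ^ w" "w > 0"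
  shows "wp S w t (fill classify) (\<lambda>k s'. k \<le> R 6 * (b + 17) + 4 \<and> env R \<mu> s' \<and> regs s' 8 = q \<and>
     has_row (mem s') W p (map f (filter P [0..<R 6])) \<and>
     (\<forall>a. a < W * p \<or> W * p + W \<le> a \<longrightarrow> mem s' a = mem s0 a)) s0"
proof -
  define L where "L = (\<lambda>i. map f (filter P [0..<i]))"
  define I where "I = (\<lambda>i s. env R \<mu> s \<and> regs s 8 = q \<and> regs s 9 = i \<and>
     regs s 10 = W * p + length (L i) \<and> has_row (mem s) W p (L i) \<and>
     (\<forall>a. a < W * p \<or> W * p + W \<le> a \<longrightarrow> mem s a = mem s0 a))"
  \<comment> \<open>Since \<open>p > 0\<close>, the row lies beyond the pattern, so writing it
    preserves \<open>env\<close>.\<close>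
  have "W * 1 \<le> W * p" using W(2) by (intro mult_left_mono) auto
  then have Wp: "R 1 < W * p" using W(1) by linarith
  have "wp S w t (fill classify) (\<lambda>k s'. k \<le> (\<Sum>i<R 6. (b + 13) + cost (Bin Less (Reg 9) Rs) + 1) +
       cost (Bin Less (Reg 9) Rs) + 1 \<and> I (R 6) s') s0"
    unfolding fill_def
  proof (rule wp_While, goal_cases)
    case 1
    show ?case using s0 by (simp add: I_def L_def has_row_def)
  next
    case (2 i s)
    have len: "length (L i) \<le> i"
      unfolding L_def using length_filter_le[of P "[0..<i]"] by simp
    have 6: "regs s 6 = R 6" using 2 by (simp add: I_def env_def)
    have "wp S w t classify (\<lambda>k s'. k \<le> b \<and> mem s' = mem s \<and> (\<forall>r<11. regs s' r = regs s r) \<and>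
        regs s' 11 = (if P i then 1 else 0) \<and> regs s' 12 = f i) s"
      using classify 2 unfolding classify_ok_def I_def by blast
    note A = wp_mono[OF this]
    have row: "has_row (mem s) W p (L i)" using 2 by (simp add: I_def)
    have bd: "W * p + i + 1 < W * p + W" "i + 1 < 2 ^ w"
      using 2 W by auto
    show ?case
      using 2(1) 6 W(6)
      apply (simp add: I_def 2[unfolded I_def] )
      apply (rule A)
      using 2 len bd W(4-6) row has_row_snoc[OF row, of "f i"] Wp
      apply (auto simp: I_def env_def L_def)
      done
  next
    case (3 s)
    then show ?case using W by (simp add: I_def env_def)
  qed
  then show ?thesis
    by (rule wp_mono) (auto simp: I_def L_def algebra_simps)
qed

lemma wp_table:
  assumes classify: "\<And>q. q < N \<Longrightarrow> classify_ok S w t classify b R \<mu> q (P q) (f q)"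
    and e: "\<And>s. env R \<mu> s \<Longrightarrow> safe S w t s e \<and> eval w t s e = N" "cost e \<le> 5"
    and be: "\<And>s. env R \<mu> s \<Longrightarrow> safe S w t s be \<and> eval w t s be = B" "cost be \<le> 5"
    and s0: "env R \<mu> s0" "\<And>a. W * B \<le> a \<Longrightarrow> a < W * (B + N) \<Longrightarrow> mem s0 a = 0"
    and W: "W = R 1 + 1" "B > 0" "R 6 \<le> R 1" "W * (B + N) \<le> S" "W * (B + N) < 2 ^ w" "w > 0"
  shows "wp S w t (table classify be e) (\<lambda>k s'. k \<le> N * (R 6 * (b + 17) + 40) + 20 \<and> env R \<mu> s' \<and>
     (\<forall>q<N. has_row (mem s') W (B + q) (map (f q) (filter (P q) [0..<R 6]))) \<and>
     (\<forall>a. a < W * B \<or> W * (B + N) \<le> a \<longrightarrow> mem s' a = mem s0 a)) s0"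
proof -
  define L where "L = (\<lambda>q. map (f q) (filter (P q) [0..<R 6]))"
  define I where "I = (\<lambda>i s. env R \<mu> s \<and> regs s 8 = i \<and>
     (\<forall>q<i. has_row (mem s) W (B + q) (L q)) \<and>
     (\<forall>a. a < W * B \<or> W * (B + i) \<le> a \<longrightarrow> mem s a = mem s0 a))"
  have WB: "W * 1 \<le> W * B" using W(2) by (intro mult_left_mono) auto
  have BN: "B + N \<le> W * (B + N)" using W(1) by simp
  have "wp S w t (While (Bin Less (Reg 8) e)
        (Seq (Assign 9 (Const 0)) (Seq (Assign 10 (row_start be (Reg 8)))
        (Seq (fill classify) (Assign 8 (Bin Plus (Reg 8) (Const 1)))))))
     (\<lambda>k s'. k \<le> (\<Sum>i<N. (R 6 * (b + 17) + 30) + cost (Bin Less (Reg 8) e) + 1) +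
       cost (Bin Less (Reg 8) e) + 1 \<and> I N s') (s0\<lparr>regs := (regs s0)(8 := 0)\<rparr>)"
  proof (rule wp_While, goal_cases)
    case 1
    show ?case using s0 by (simp add: I_def env_def)
  next
    case (2 i s)
    have env: "env R \<mu> s" using 2 by (simp add: I_def)
    have WBi: "W * (B + i) + W = W * (B + Suc i)" by simp
    have WBN: "W * (B + Suc i) \<le> W * (B + N)" using 2 by (intro mult_left_mono) auto
    have row0: "mem s (W * (B + i) + c) = 0" if "c < W" for c
    proof -
      have "mem s (W * (B + i) + c) = mem s0 (W * (B + i) + c)"
        using 2 by (simp add: I_def)
      also have "\<dots> = 0"
        using WBi WBN that by (intro s0(2)) (simp_all add: add_increasing2 distrib_left)
      finally show ?thesis .
    qed
    have start: "eval w t (s\<lparr>regs := (regs s)(9 := 0)\<rparr>) (row_start be (Reg 8)) = W * (B + i)"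
        "safe S w t (s\<lparr>regs := (regs s)(9 := 0)\<rparr>) (row_start be (Reg 8))"
    proof -
      have env': "env R \<mu> (s\<lparr>regs := (regs s)(9 := 0)\<rparr>)" using env by (simp add: env_def)
      have "regs s 8 = i" "regs s (Suc 0) = R (Suc 0)" using 2 by (auto simp: I_def env_def)
      moreover have "W < 2 ^ w" using WB W WBi WBN 2 by simp
      moreover have "B + i < 2 ^ w" "W * (B + i) < 2 ^ w" using BN WBi WBN W 2 by auto
      ultimately show "eval w t (s\<lparr>regs := (regs s)(9 := 0)\<rparr>) (row_start be (Reg 8)) = W * (B + i)"
        "safe S w t (s\<lparr>regs := (regs s)(9 := 0)\<rparr>) (row_start be (Reg 8))"
        using be(1)[OF env'] W by (simp_all add: row_start_def)
    qed
    let ?s = "s\<lparr>regs := (regs s)(9 := 0, 10 := W * (B + i))\<rparr>"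
    have A: "wp S w t (fill classify) (\<lambda>k s'. k \<le> R 6 * (b + 17) + 4 \<and> env R \<mu> s' \<and> regs s' 8 = i \<and>
       has_row (mem s') W (B + i) (map (f i) (filter (P i) [0..<R 6])) \<and>
       (\<forall>a. a < W * (B + i) \<or> W * (B + i) + W \<le> a \<longrightarrow> mem s' a = mem ?s a)) ?s"
    proof (rule wp_fill[OF classify])
      show "env R \<mu> ?s" using env by (simp add: env_def)
      show "W * (B + i) + W \<le> S" "W * (B + i) + W < 2 ^ w"
        using WBi WBN W by linarith+
    qed (use 2 W row0 in \<open>auto simp: I_def\<close>)
    have i: "i < 2 ^ w" "Suc i < 2 ^ w" using BN W 2 by auto
    have st: "safe S w t s (Bin Less (Reg 8) e) \<and> eval w t s (Bin Less (Reg 8) e) \<noteq> 0"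
      using 2 e(1)[OF env] W(6) by (simp add: I_def)
    have "wp S w t (fill classify) (\<lambda>k. wp S w t (Assign 8 (Bin Plus (Reg 8) (Const 1)))
        (\<lambda>k' s'. 2 + (Suc (cost (row_start be (Reg 8))) + (k + k')) \<le> R 6 * (b + 17) + 30 \<and> I (Suc i) s')) ?s"
    proof (rule wp_mono[OF A], goal_cases)
      case (1 k s')
      have R: "has_row (mem s') W (B + q) (L q)" if "q < Suc i" for q
      proof (cases "q = i")
        case True
        then show ?thesis using 1 by (simp add: L_def)
      next
        case False
        \<comment> \<open>An earlier row ends before row \<open>B + i\<close> starts and therefore
          survives.\<close>
        with that have "W * (B + Suc q) \<le> W * (B + i)" by (intro mult_left_mono) auto
        then have "W * (B + q) + W \<le> W * (B + i)" by simp
        moreover have "has_row (mem s) W (B + q) (L q)" using 2 False that by (simp add: I_def)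
        ultimately show ?thesis using 1 by (elim has_row_cong) auto
      qed
      have "a < W * (B + i)" if "a < W * B" for a using that by (simp add: distrib_left)
      moreover have "W * (B + i) \<le> a \<and> W * (B + i) + W \<le> a" if "W * (B + Suc i) \<le> a" for a
        using that by (simp add: distrib_left)
      ultimately have "mem s' a = mem s0 a" if "a < W * B \<or> W * (B + Suc i) \<le> a" for a
        using that 1 2 unfolding I_def by auto
      then show ?case
        using 1 R W(6) i be(2) by (simp add: I_def row_start_def env_def)
    qed
    then show ?case
      using st start W(6) by (simp add: numeral_eq_Suc)
  next
    case (3 s)
    then show ?case using e(1)[of s] W(6) by (simp add: I_def)
  qed
  then have "wp S w t (table classify be e) (\<lambda>k s'. k \<le> 2 + ((\<Sum>i<N. (R 6 * (b + 17) + 30) + cost (Bin Less (Reg 8) e) + 1) +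
       cost (Bin Less (Reg 8) e) + 1) \<and> I N s') s0"
    unfolding table_def using W(6) by (auto elim!: wp_mono)
  then show ?thesis
  proof (rule wp_mono, goal_cases)
    case (1 k s')
    have "(\<Sum>i<N. (R 6 * (b + 17) + 30) + cost (Bin Less (Reg 8) e) + 1) \<le> 
       (\<Sum>i<N. R 6 * (b + 17) + 40)" by (intro sum_mono) (use e(2) in simp)
    also have "\<dots> = N * (R 6 * (b + 17) + 40)" by simp
    finally have "k \<le> N * (R 6 * (b + 17) + 40) + 20"
      using 1 e(2) unfolding cost.simps by linarith
    then show ?case using 1 by (simp add: I_def L_def)
  qed
qed

section \<open>Block length and alphabet reduction\<close>

locale wildcard_pattern =
  fixes \<sigma> m g :: nat and x :: "nat option list" and w :: nat
  assumes \<sigma>: "\<sigma> \<ge> 2" and m: "m \<ge> 1" and len: "length x = m"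
    and x: "set x \<subseteq> insert None (Some ` {..<\<sigma>})" and g: "count_list x None = g"
    and dens: "real g / real m < 1 / 2 - 3 * log (real \<sigma>) (real m) / real m"
    and \<sigma>w: "\<sigma> < 2 ^ w" and mw: "(m + 1) ^ 8 \<le> 2 ^ w"
begin

text \<open>If \<open>M \<noteq> \<sigma>\<close>, distinct letters may have the same residue, but then \<open>l = 1\<close>.\<close>

definition "M = min \<sigma> m"
text \<open>The outer \<open>Suc\<close> keeps blocks nonempty even for
  \<open>m = 1\<close>.\<close>

definition "l = Suc (LEAST i. m \<le> M ^ Suc i)"
definition "K = M ^ l"
text \<open>The spacing of the blocks, and also the number of offsets at which a block fits into the
  pattern.\<close>

definition "s = m + 1 - l"
definition "code p = (case x ! p of Some a \<Rightarrow> a | None \<Rightarrow> \<sigma>)"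

lemma M: "1 \<le> M" "M \<le> m" "M \<le> \<sigma>"
  using \<sigma> m by (auto simp: M_def)

lemma code_wild: "p < m \<Longrightarrow> code p = \<sigma> \<longleftrightarrow> x ! p = None"
  using x len by (auto simp: code_def split: option.splits dest!: nth_mem)

lemma code_le: "p < m \<Longrightarrow> code p \<le> \<sigma>"
  using x len by (auto simp: code_def split: option.splits dest!: nth_mem)

text \<open>The minimum in \<open>l\<close> is attained: if \<open>\<sigma> < m\<close>, the powers
  of \<open>M = \<sigma> \<ge> 2\<close> outgrow \<open>m\<close>; otherwise \<open>M = m\<close>
  and exponent 1 suffices.\<close>

lemma l_ge: "m \<le> M ^ l"
proof -
  have "\<exists>i. m \<le> M ^ Suc i"
  proof (cases "\<sigma> < m")
    case True
    have "m < 2 ^ m" by (rule less_exp)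
    also have "(2::nat) ^ m \<le> 2 ^ Suc m" by simp
    also have "(2::nat) ^ Suc m \<le> \<sigma> ^ Suc m" using \<sigma> by (intro power_mono) auto
    finally show ?thesis using True by (intro exI[of _ m]) (simp add: M_def)
  qed (auto simp: M_def intro: exI[of _ 0])
  from LeastI_ex[OF this] show ?thesis by (simp add: l_def)
qed

lemma l_least: "1 \<le> i \<Longrightarrow> i < l \<Longrightarrow> M ^ i < m"
  using not_less_Least[of "i - 1" "\<lambda>i. m \<le> M ^ Suc i"] by (cases i) (auto simp: l_def)

lemma l1: "1 \<le> l" by (simp add: l_def)

text \<open>If \<open>M\<close> differs from \<open>\<sigma>\<close>, it equals \<open>m\<close>, so
  the first power already reaches \<open>m\<close>.\<close>

lemma l_eq_1: "M \<noteq> \<sigma> \<Longrightarrow> l = 1"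
  using l_least[of 1] l1 by (cases "l = 1") (auto simp: M_def min_def split: if_splits)

lemma log_nonneg: "0 \<le> log (real \<sigma>) (real m)"
  using \<sigma> m by simp

lemma l_log: "real l \<le> 1 + log (real \<sigma>) (real m)"
proof (cases "l = 1")
  case False
  then have "M = \<sigma>" "M ^ (l - 1) < m" using l_eq_1 l_least[of "l - 1"] l1 by auto
  then have "real (\<sigma> ^ (l - 1)) < real m" by simp
  then have "real (l - 1) < log (real \<sigma>) (real m)"
    using \<sigma> by (intro less_log_of_power) auto
  then show ?thesis using l1 by simp
qed (use log_nonneg in simp)

text \<open>As \<open>g\<close> is nonnegative, the density condition forces
  \<open>6 * log\<^sub>\<sigma> m < m\<close>. Blocks are thus short compared with the pattern, so
  \<open>s\<close> is at least \<open>m / 2\<close> and there are only \<open>O(n/m)\<close>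
  blocks.\<close>

lemma l_small: "6 * (l - 1) < m"
proof -
  have "0 \<le> real g / real m" by simp
  with dens have "3 * log (real \<sigma>) (real m) / real m < 1 / 2" by linarith
  then have "6 * log (real \<sigma>) (real m) < real m" using m by (simp add: field_simps)
  with l_log l1 have "6 * real (l - 1) < real m" by simp
  then show ?thesis by linarith
qed

lemma l_le: "l \<le> m" using l_small l1 by linarith

lemma s: "1 \<le> s" "s \<le> m" "s + l = m + 1" "m \<le> 2 * s"
  using l_small l1 l_le unfolding s_def by linarith+

text \<open>The upper bound comes from minimality: for \<open>l > 1\<close>,
  \<open>M ^ (l - 1) < m\<close>, and one more factor \<open>M\<close> is at most \<open>m\<close>.
  It keeps the candidate table polynomial.\<close>

lemma K: "m \<le> K" "K \<le> m * m" "1 \<le> K"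
proof -
  show "m \<le> K" using l_ge by (simp add: K_def)
  then show "1 \<le> K" using m by simp
  show "K \<le> m * m"
  proof (cases "l = 1")
    case True
    then show ?thesis using M m by (simp add: K_def) (metis le_square le_trans)
  next
    case False
    have "K = M ^ (l - 1) * M" using l1 by (simp add: K_def flip: power_Suc2)
    also have "\<dots> \<le> m * m" using less_imp_le[OF l_least[of "l - 1"]] False l1 M by (intro mult_mono) auto
    finally show ?thesis .
  qed
qed

lemma word_bound: "16 * (m + 1) ^ 4 \<le> 2 ^ w"
proof -
  have "16 * (m + 1) ^ 4 = 2 ^ 4 * (m + 1) ^ 4" by simp
  also have "(2::nat) ^ 4 * (m + 1) ^ 4 \<le> (m + 1) ^ 4 * (m + 1) ^ 4"
    using m by (intro mult_mono power_mono) auto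
  also have "\<dots> = (m + 1) ^ 8" by (simp flip: power_add)
  finally show "16 * (m + 1) ^ 4 \<le> 2 ^ w" using mw by simp
qed

end

section \<open>Preprocessing\<close>

text \<open>The inner equality detects a wildcard; comparing its truth value with 0 negates
  it.\<close>

definition classify_probe :: com where
  "classify_probe =
     Seq (Assign 12 (Bin Modulo (Bin Plus (Bin Plus (Reg 9) (Reg 8)) Rl) Rm))
    (Seq (Assign 11 (Bin Equal (Bin Equal (Mem (Reg 12)) RS) (Const 0)))
         (Assign 12 (Bin Plus (Reg 12) (Const 1))))"

text \<open>Register 13 runs through the quotients of the row number by powers of \<open>M\<close>,
  whose residues are its digits. Register 11 accumulates the conjunction of the tests, with bit
  operations acting on truth values.\<close>

definition classify_cand :: com where
  "classify_cand =
     Seq (Assign 11 (Const 1))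
    (Seq (Assign 13 (Reg 8))
    (Seq (Assign 14 (Const 0))
    (Seq (While (Bin Less (Reg 14) Rl)
           (Seq (Assign 11 (Bin BitAnd (Reg 11)
                  (Bin BitOr (Bin Equal (Mem (Bin Plus (Reg 9) (Reg 14))) RS)
                    (Bin Equal (Bin Modulo (Mem (Bin Plus (Reg 9) (Reg 14))) RM)
                       (Bin Modulo (Reg 13) RM)))))
           (Seq (Assign 13 (Bin Divide (Reg 13) RM))
                (Assign 14 (Bin Plus (Reg 14) (Const 1))))))
         (Assign 12 (Bin Plus (Reg 9) (Const 1))))))"

definition params :: com where
  "params =
     Seq (Cond (Bin Less RS Rm) (Assign 3 RS) (Assign 3 Rm))
    (Seq (Assign 4 (Const 1))
    (Seq (Assign 5 RM)
    (Seq (While (Bin Less RK Rm)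
           (Seq (Assign 5 (Bin Times RK RM)) (Assign 4 (Bin Plus Rl (Const 1)))))
         (Assign 6 (Bin Minus (Bin Plus Rm (Const 1)) Rl)))))"

definition preprocess :: com where
  "preprocess =
     Seq params
    (Seq (table classify_probe (Const 1) Rs)
         (table classify_cand (Bin Plus Rm (Const 1)) RK))"

context wildcard_pattern
begin

definition R :: "nat \<Rightarrow> nat \<Rightarrow> nat" where
  "R n r = (if r = 0 then \<sigma> else if r = 1 then m else if r = 2 then n else
   if r = 3 then M else if r = 4 then l else if r = 5 then K else if r = 6 then s else 0)"

lemma R [simp]: "R n 0 = \<sigma>" "R n 1 = m" "R n (Suc 0) = m" "R n 2 = n" "R n 3 = M" "R n 4 = l"
  "R n 5 = K" "R n 6 = s"
  by (simp_all add: R_def)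

lemma envD:
  assumes "env (R n) code st"
  shows "regs st 0 = \<sigma>" "regs st 1 = m" "regs st (Suc 0) = m" "regs st 2 = n" "regs st 3 = M"
    "regs st 4 = l" "regs st 5 = K" "regs st 6 = s" "a < m \<Longrightarrow> mem st a = code a"
  using assms by (auto simp: env_def)

text \<open>\<open>y\<close> is read as a numeral in base \<open>M\<close>, least significant digit
  first, whose digits are the reduced letters of a block.\<close>

definition cand :: "nat \<Rightarrow> nat \<Rightarrow> bool" where
  "cand y j \<longleftrightarrow> (\<forall>r<l. code (j + r) = \<sigma> \<or> code (j + r) mod M = y div M ^ r mod M)"

text \<open>A cyclic order that starts right behind the block and, at \<open>i = s - 1\<close>,
  arrives at \<open>j\<close> itself; it omits just the other \<open>l - 1\<close> positions of the
  block.\<close>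

definition site :: "nat \<Rightarrow> nat \<Rightarrow> nat" where
  "site j i = (i + j + l) mod m"
definition "probes j = map (site j) (filter (\<lambda>i. code (site j i) \<noteq> \<sigma>) [0..<s])"
definition "cands y = filter (cand y) [0..<s]"

text \<open>The product is the space taken by all rows of width \<open>m + 1\<close>: one for the
  pattern, \<open>m\<close> reserved for probes, \<open>K\<close> for candidates. With
  \<open>K \<le> m * m\<close> it is of order \<open>m ^ 3\<close>.\<close>

lemma size_bound: "(m + 1) * (m + 1 + K) \<le> 6 * m ^ 4" "(m + 1) * (m + 1 + K) < 2 ^ w"
  "(m + 1) * (m + 1 + K) \<le> 2 * (m + 1) ^ 4"
proof -
  have "(m + 1) * (m + 1 + K) \<le> (2 * m) * (3 * (m * m))"
    using K m mult_le_mono[OF m m] mult_le_mono[OF m order_refl[of m]] by (intro mult_mono) auto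
  also have "\<dots> = 6 * m ^ 3" by (simp add: power3_eq_cube)
  also have "\<dots> \<le> 6 * m ^ 4" using m by (intro mult_left_mono power_increasing) auto
  finally show "(m + 1) * (m + 1 + K) \<le> 6 * m ^ 4" .
  have "(m + 1) * (m + 1 + K) \<le> (m + 1) * (2 * (m + 1) * (m + 1))"
    using K m by (intro mult_left_mono) (auto simp: algebra_simps)
  also have "\<dots> = 2 * (m + 1) ^ 3" by (simp add: power3_eq_cube)
  also have "\<dots> \<le> 2 * (m + 1) ^ 4" using m by (intro mult_left_mono power_increasing) auto
  finally show 1: "(m + 1) * (m + 1 + K) \<le> 2 * (m + 1) ^ 4" .
  have "2 * (m + 1) ^ 4 < 16 * (m + 1) ^ 4" by simp
  also have "\<dots> \<le> 2 ^ w" by (rule word_bound)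
  finally show "(m + 1) * (m + 1 + K) < 2 ^ w" using 1 by (rule le_less_trans[rotated])
qed

lemma w_pos: "w > 0"
  using \<sigma>w \<sigma> by (cases w) auto

lemma small: "4 * m + 4 < 2 ^ w" "K < 2 ^ w" "m * K < 2 ^ w"
proof -
  have "4 * (m + 1) \<le> 4 * (m + 1) ^ 4" by (intro mult_left_mono self_le_power) auto
  also have "\<dots> < 16 * (m + 1) ^ 4" by simp
  also have "\<dots> \<le> 2 ^ w" by (rule word_bound)
  finally show "4 * m + 4 < 2 ^ w" by simp
  have "m * K \<le> (m + 1) * (m + 1 + K)" by (intro mult_mono) auto
  then show mK: "m * K < 2 ^ w" using size_bound(2) by linarith
  have "1 * K \<le> m * K" using m by (intro mult_mono) auto
  then show "K < 2 ^ w" using mK by linarith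
qed

section \<open>Runs of the preprocessing commands\<close>

lemma classify_probe_ok:
  assumes "m \<le> S" and "q < s"
  shows "classify_ok S w t classify_probe 20 (R n) code q (\<lambda>i. code (site q i) \<noteq> \<sigma>) (\<lambda>i. Suc (site q i))"
  unfolding classify_ok_def
proof (intro allI impI, goal_cases)
  case (1 st i)
  have p: "site q i < m" using m by (simp add: site_def)
  have "i + q + l < 2 ^ w" using 1 assms small s by simp
  then show ?case
    using 1 p assms small w_pos by (simp add: classify_probe_def envD site_def[symmetric])
qed

lemma classify_cand_ok:
  assumes "m \<le> S" and "q < K"
  shows "classify_ok S w t classify_cand (40 * m + 30) (R n) code q (cand q) Suc"
  unfolding classify_ok_def
proof (intro allI impI, goal_cases)
  case (1 st i)
  define P where "P = (\<lambda>r. code (i + r) = \<sigma> \<or> code (i + r) mod M = q div M ^ r mod M)"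
  define I where "I = (\<lambda>k (st' :: state). mem st' = mem st \<and> (\<forall>r<11. regs st' r = regs st r) \<and> regs st' 14 = k \<and>
     regs st' 13 = q div M ^ k \<and> regs st' 11 = (if \<forall>r<k. P r then 1 else 0))"
  have sm: "i + r < m" "Suc r < 2 ^ w" "i + r < 2 ^ w" if "r < l" for r
    using that 1 s small by auto
  have q: "q < 2 ^ w" "1 < (2::nat) ^ w" "Suc i < 2 ^ w" using assms small s 1 w_pos by auto
  have "wp S w t (While (Bin Less (Reg 14) Rl)
           (Seq (Assign 11 (Bin BitAnd (Reg 11)
                  (Bin BitOr (Bin Equal (Mem (Bin Plus (Reg 9) (Reg 14))) RS)
                    (Bin Equal (Bin Modulo (Mem (Bin Plus (Reg 9) (Reg 14))) RM)
                       (Bin Modulo (Reg 13) RM)))))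
           (Seq (Assign 13 (Bin Divide (Reg 13) RM))
                (Assign 14 (Bin Plus (Reg 14) (Const 1))))))
      (\<lambda>k s'. k \<le> (\<Sum>i<l. 28 + cost (Bin Less (Reg 14) Rl) + 1) + cost (Bin Less (Reg 14) Rl) + 1 \<and> I l s')
     (st\<lparr>regs := (regs st)(11 := 1, 13 := q, 14 := 0)\<rparr>)"
  proof (rule wp_While, goal_cases)
    case (2 k st')
    then have env: "env (R n) code st'" and 9: "regs st' 9 = i" using 1 by (simp_all add: I_def env_def)
    from 2(2) have I: "mem st' = mem st" "\<And>r. r < 11 \<Longrightarrow> regs st' r = regs st r" "regs st' 14 = k"
        "regs st' 13 = q div M ^ k" "regs st' 11 = (if \<forall>r<k. P r then 1 else 0)"
      by (simp_all add: I_def)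
    have P: "(\<forall>r<Suc k. P r) \<longleftrightarrow> (\<forall>r<k. P r) \<and> P k" by (auto simp: less_Suc_eq)
    have code: "mem st (i + k) = code (i + k)"
      using envD(9)[OF env] sm(1)[OF 2(1)] I(1) by simp
    have le: "i + k < S" using sm(1)[OF 2(1)] assms by simp
    have div: "q div M ^ k div M = q div M ^ Suc k" by (simp add: div_mult2_eq power_Suc2 del: power_Suc)
    show ?case
      using sm[OF 2(1)] 2(1) w_pos le
      by (simp add: envD(1-8)[OF env] 9 I(1,3-5) code div P fun_cong[OF P_def, of k] I_def I(2)[symmetric] del: power_Suc)
  next
    case (3 st')
    then have env: "env (R n) code st'" and 14: "regs st' 14 = l"
      using 1 by (simp_all add: I_def env_def)
    then show ?case using w_pos by (simp add: envD(1-8)[OF env] 14)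
  qed (simp add: I_def)
  note A = wp_mono[OF this]
  have "32 * l \<le> 32 * m" using l_le by simp
  then show ?case
    unfolding classify_cand_def
    using 1 q w_pos
    apply (simp del: One_nat_def split del: if_split)
    apply (rule A)
    apply (auto simp: I_def cand_def P_def)
    done
qed

lemma wp_params:
  "wp S w t params (\<lambda>k st. k \<le> 20 * m + 30 \<and> env (R 0) code st \<and> mem st = mem (pattern_start \<sigma> x))
     (pattern_start \<sigma> x)"
proof -
  let ?s = "pattern_start \<sigma> x"
  define I where "I = (\<lambda>i (st :: state). mem st = mem ?s \<and> regs st = (regs ?s)(3 := M, 4 := Suc i, 5 := M ^ Suc i))"
  have ls: "l < 2 ^ w" "1 < (2::nat) ^ w" "m + 1 < 2 ^ w" using small l_le by linarith+
  \<comment> \<open>Here \<open>v\<close> is whichever of \<open>\<sigma>\<close> and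
    \<open>m\<close> the conditional has stored, so both branches share this loop.\<close>
  have "wp S w t (While (Bin Less RK Rm)
           (Seq (Assign 5 (Bin Times RK RM)) (Assign 4 (Bin Plus Rl (Const 1)))))
      (\<lambda>k s'. k \<le> (\<Sum>i<l - 1. 9 + cost (Bin Less RK Rm) + 1) + cost (Bin Less RK Rm) + 1 \<and> I (l - 1) s')
      (?s\<lparr>regs := (regs ?s)(3 := v, 4 := 1, 5 := v)\<rparr>)" if "v = M" for v
    unfolding that
  proof (rule wp_While, goal_cases)
    case (2 i st)
    \<comment> \<open>Minimality of \<open>l\<close> keeps the loop running for \<open>l - 1\<close>
      rounds.\<close>
    have "M ^ Suc i < m" using l_least[of "Suc i"] 2 by simp
    moreover have "M ^ Suc i * M \<le> M ^ l"
      using 2 M by (subst power_Suc2[symmetric], intro power_increasing) auto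
    then have "M ^ Suc i * M < 2 ^ w" using small by (simp add: K_def)
    ultimately show ?case using 2 w_pos ls l_le
      by (auto simp: I_def pattern_start_def len fun_upd_twist mult_ac)
  next
    case (3 st)
    show ?case using 3 w_pos l_ge l1 by (cases l) (auto simp: I_def pattern_start_def len)
  qed (simp add: I_def)
  note A = wp_mono[OF this]
  have pre: "regs ?s 0 = \<sigma>" "regs ?s 1 = m" "regs ?s (Suc 0) = m" by (simp_all add: pattern_start_def len)
  have bd: "19 * (l - 1) \<le> 20 * m" using l_le by linarith
  have K': "M ^ Suc (l - 1) = K" "Suc (l - 1) = l" using l1 by (simp_all add: K_def del: power_Suc)
  have env: "env (R 0) code (st\<lparr>regs := (regs st)(6 := s)\<rparr>)" if "I (l - 1) st" for st
    using that unfolding I_def K'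
    by (auto simp: env_def pattern_start_def len R_def code_def K_def)
  have sub: "(m + 1 + 2 ^ w - l) mod 2 ^ w = s"
    using l_le ls by (subst word_minus) (auto simp: s_def)
  have fin: "k \<le> 19 * (l - 1) + 5 \<Longrightarrow> I (l - 1) st \<Longrightarrow>
      m + 1 < 2 ^ w \<and> regs st 1 = m \<and> regs st 4 = l \<and> env (R 0) code (st\<lparr>regs := (regs st)(6 := s)\<rparr>) \<and>
      mem st = mem ?s \<and> k \<le> 20 * m + 5" for k st
    using bd env[of st] ls K' by (auto simp: I_def pre)
  show ?thesis
  proof (cases "\<sigma> < m")
    case True
    then have M: "\<sigma> = M" by (simp add: M_def)
    show ?thesis
      unfolding params_def using True w_pos ls
      apply (simp add: pre del: One_nat_def)
      apply (rule A[OF M])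
      subgoal for k st using fin[of k st] sub by auto
      done
  next
    case False
    then have M: "m = M" by (simp add: M_def)
    show ?thesis
      unfolding params_def using False w_pos ls
      apply (simp add: pre del: One_nat_def)
      apply (rule A[OF M])
      subgoal for k st using fin[of k st] sub by auto
      done
  qed
qed

text \<open>The memory consists of rows of length \<open>m + 1\<close>: the pattern is in row 0, the probes of offset
  \<open>j\<close> in row \<open>1 + j\<close>, the candidates of block \<open>y\<close> in row \<open>m + 1 + y\<close>. Entries are incremented, so
  that the initial zeros terminate each list.\<close>

definition ready :: "nat \<Rightarrow> state \<Rightarrow> bool" where
  "ready n st \<longleftrightarrow> env (R n) code st \<and>
     (\<forall>j<s. has_row (mem st) (m + 1) (1 + j) (map Suc (probes j))) \<and>
     (\<forall>y<K. has_row (mem st) (m + 1) (m + 1 + y) (map Suc (cands y)))"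

text \<open>The candidate table dominates the time: \<open>K \<le> m * m\<close> rows,
  \<open>s \<le> m\<close> offsets for each, and \<open>O(m)\<close> steps to test one
  offset.\<close>

lemma preprocess_correct:
  assumes "6 * m ^ 4 \<le> S"
  shows "wp S w [] preprocess (\<lambda>k st. k \<le> 1000 * m ^ 4 \<and> ready 0 st) (pattern_start \<sigma> x)"
proof -
  let ?x = "mem (pattern_start \<sigma> x)"
  have zero: "?x a = 0" if "m \<le> a" for a using that by (simp add: pattern_start_def len)
  have mS: "m \<le> S"
    using self_le_power[of m 4] m assms by simp
  have sz: "(m + 1) * (1 + s) \<le> (m + 1) * (m + 1 + K)" using s by (intro mult_left_mono) auto
  note sb = size_bound(1,2)
  have 1: "wp S w [] (table classify_probe (Const 1) Rs)
      (\<lambda>k st. k \<le> s * (s * (20 + 17) + 40) + 20 \<and> env (R 0) code st \<and>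
        (\<forall>j<s. has_row (mem st) (m + 1) (1 + j) (map Suc (probes j))) \<and>
        (\<forall>a. a < (m + 1) * 1 \<or> (m + 1) * (1 + s) \<le> a \<longrightarrow> mem st a = ?x a)) st"
    if "env (R 0) code st" "mem st = ?x" for st
  proof (rule wp_mono, rule wp_table[where N = s and B = 1 and W = "m + 1" and R = "R 0"])
    show "classify_ok S w [] classify_probe 20 (R 0) code q (\<lambda>i. code (site q i) \<noteq> \<sigma>) (\<lambda>i. Suc (site q i))"
      if "q < s" for q using mS that by (rule classify_probe_ok)
    show "(m + 1) * (1 + s) \<le> S" "(m + 1) * (1 + s) < 2 ^ w"
      using sz sb assms by linarith+
  qed (use that w_pos s zero in \<open>auto simp: envD probes_def comp_def\<close>)
  have 2: "wp S w [] (table classify_cand (Bin Plus Rm (Const 1)) RK)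
      (\<lambda>k st'. k \<le> K * (s * (40 * m + 30 + 17) + 40) + 20 \<and> env (R 0) code st' \<and>
        (\<forall>y<K. has_row (mem st') (m + 1) (m + 1 + y) (map Suc (cands y))) \<and>
        (\<forall>a. a < (m + 1) * (m + 1) \<or> (m + 1) * (m + 1 + K) \<le> a \<longrightarrow> mem st' a = mem st a)) st"
    if "env (R 0) code st" "\<And>a. (m + 1) * (m + 1) \<le> a \<Longrightarrow> mem st a = 0" for st
  proof (rule wp_mono, rule wp_table[where N = K and B = "m + 1" and W = "m + 1" and R = "R 0"])
    show "classify_ok S w [] classify_cand (40 * m + 30) (R 0) code q (cand q) Suc"
      if "q < K" for q using mS that by (rule classify_cand_ok)
    show "(m + 1) * (m + 1 + K) \<le> S" "(m + 1) * (m + 1 + K) < 2 ^ w"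
      using sb assms by linarith+
  qed (use that w_pos s small in \<open>auto simp: envD cands_def\<close>)
  \<comment> \<open>The probe rows end before row \<open>m + 1\<close>: the candidate cells are
    still zero when their turn comes, and filling them leaves the probes intact.\<close>
  have mm: "(m + 1) * (1 + s) \<le> (m + 1) * (m + 1)" using s by (intro mult_left_mono) auto
  have jrow: "(m + 1) * (1 + j) + c < (m + 1) * (m + 1)" if "j < s" "c < m + 1" for j c
  proof -
    have "(m + 1) * (1 + Suc j) \<le> (m + 1) * (m + 1)" using s that by (intro mult_left_mono) auto
    then show ?thesis using that by simp
  qed
  have time: "(20 * m + 30) + (s * (s * (20 + 17) + 40) + 20) + (K * (s * (40 * m + 30 + 17) + 40) + 20)
     \<le> 1000 * m ^ 4"
  proof -
    have p: "m ^ i \<le> m ^ 4" if "i \<le> 4" for i using m that by (intro power_increasing) auto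
    have "s * (s * (20 + 17) + 40) \<le> m * (m * (20 + 17) + 40 * m)"
      using s m by (intro mult_mono add_mono) auto
    moreover have "K * (s * (40 * m + 30 + 17) + 40) \<le> (m * m) * (m * (87 * m) + 40)"
      using s m K by (intro mult_mono add_right_mono) auto
    moreover have "m * (m * (20 + 17) + 40 * m) = 77 * m ^ 2"
      "(m * m) * (m * (87 * m) + 40) = 87 * m ^ 4 + 40 * m ^ 2"
      by (simp_all add: algebra_simps power2_eq_square power4_eq_xxxx)
    ultimately show ?thesis using p[of 0] p[of 1] p[of 2] by simp
  qed
  show ?thesis
    unfolding preprocess_def wp_Seq
  proof (rule wp_mono[OF wp_params], elim conjE, rule wp_mono[OF 1], assumption, assumption,
      elim conjE, rule wp_mono[OF 2], assumption, goal_cases)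
    case (1 k0 st0 k1 st1 a)
    then have "mem st1 a = ?x a" using mm by auto
    then show ?case using zero[of a] 1 by simp
  next
    case (2 k0 st0 k1 st1 k2 st2)
    have "has_row (mem st2) (m + 1) (1 + j) (map Suc (probes j))" if "j < s" for j
    proof (rule has_row_cong)
      show "has_row (mem st1) (m + 1) (1 + j) (map Suc (probes j))" using 2 that by blast
      show "mem st2 ((m + 1) * (1 + j) + c) = mem st1 ((m + 1) * (1 + j) + c)" if "c < m + 1" for c
        using 2 jrow[OF \<open>j < s\<close> that] by blast
    qed
    moreover have "k0 + (k1 + k2) \<le> 1000 * m ^ 4" using 2 time by linarith
    ultimately show ?case using 2 by (simp add: ready_def)
  qed
qed

end

section \<open>The search\<close>

text \<open>Horner's rule from the right end of the block; register 11 moves down to the block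
  start.\<close>

definition hash :: com where
  "hash =
     Seq (Assign 9 (Const 0))
    (Seq (Assign 11 (Bin Plus (Reg 8) Rl))
         (While (Bin Less (Reg 8) (Reg 11))
           (Seq (Assign 11 (Bin Minus (Reg 11) (Const 1)))
                (Assign 9 (Bin Plus (Bin Modulo (Txt (Reg 11)) RM) (Bin Times RM (Reg 9)))))))"

text \<open>Subtracting the truth value \<open>0 < Mem (Reg 14)\<close> keeps both addresses in range when the entry
  is the terminator \<open>0\<close>: conditions are evaluated completely.\<close>

definition compare :: com where
  "compare =
     While (Bin BitAnd (Bin Less (Const 0) (Mem (Reg 14)))
             (Bin Equal
               (Txt (Bin Minus (Bin Plus (Reg 13) (Mem (Reg 14))) (Bin Less (Const 0) (Mem (Reg 14)))))
               (Mem (Bin Minus (Mem (Reg 14)) (Bin Less (Const 0) (Mem (Reg 14)))))))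
       (Assign 14 (Bin Plus (Reg 14) (Const 1)))"

text \<open>The conditions \<open>j \<le> a\<close> and \<open>a + m \<le> n + j\<close>, which
  place the window inside the text, are arranged so that no difference can wrap around.\<close>

definition verify :: com where
  "verify =
     Seq (Assign 12 (Bin Minus (Mem (Reg 10)) (Const 1)))
      (Cond (Bin BitAnd (Bin Less (Reg 12) (Bin Plus (Reg 8) (Const 1)))
               (Bin Less (Bin Plus (Reg 8) Rm) (Bin Plus Rn (Bin Plus (Reg 12) (Const 1)))))
        (Seq (Assign 13 (Bin Minus (Reg 8) (Reg 12)))
        (Seq (Assign 14 (row_start (Const 1) (Reg 12)))
        (Seq compare
             (Cond (Mem (Reg 14)) Skip (Output (Reg 13))))))
        Skip)"

definition scan :: com where
  "scan = While (Mem (Reg 10)) (Seq verify (Assign 10 (Bin Plus (Reg 10) (Const 1))))"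

definition search :: com where
  "search =
     Seq (Assign 8 (Const 0))
      (While (Bin Less (Bin Plus (Reg 8) Rl) (Bin Plus Rn (Const 1)))
        (Seq hash
        (Seq (Assign 10 (row_start (Bin Plus Rm (Const 1)) (Reg 9)))
        (Seq scan
             (Assign 8 (Bin Plus (Reg 8) Rs))))))"

lemma takeWhile_sat: "k < length (takeWhile P xs) \<Longrightarrow> P (xs ! k)"
  by (metis nth_mem set_takeWhileD takeWhile_nth)

context wildcard_pattern
begin

section \<open>Block keys and numbers of comparisons\<close>

fun key :: "nat list \<Rightarrow> nat \<Rightarrow> nat \<Rightarrow> nat" where
  "key t a 0 = 0"
| "key t a (Suc k) = t ! a mod M + M * key t (Suc a) k"

lemma key_less: "key t a k < M ^ k"
proof (induction k arbitrary: a)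
  case (Suc k)
  have "t ! a mod M < M" using M by simp
  moreover have "M * (key t (Suc a) k + 1) \<le> M * M ^ k"
    using Suc[of "Suc a"] by (intro mult_left_mono) (auto simp: Suc_le_eq)
  ultimately show ?case by simp
qed simp

lemma key_digit: "r < k \<Longrightarrow> key t a k div M ^ r mod M = t ! (a + r) mod M"
proof (induction k arbitrary: a r)
  case (Suc k)
  show ?case
  proof (cases r)
    case 0
    then show ?thesis by simp
  next
    case (Suc r')
    have "key t a (Suc k) div M = key t (Suc a) k" using M by simp
    then show ?thesis using Suc Suc.IH[of r' "Suc a"] Suc.prems by (simp add: div_mult2_eq)
  qed
qed simp

text \<open>Only successful comparisons are counted; the one that ends the loop is charged to the
  constant cost of a candidate.\<close>

definition hits :: "nat list \<Rightarrow> nat \<Rightarrow> nat \<Rightarrow> nat" where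
  "hits t i j = length (takeWhile (\<lambda>p. t ! (i + p) = code p) (probes j))"

lemma hits_match: "k < hits t i j \<Longrightarrow> t ! (i + probes j ! k) = code (probes j ! k)"
  unfolding hits_def
  by (rule takeWhile_sat[where P = "\<lambda>p. t ! (i + p) = code p"])

definition valid :: "nat list \<Rightarrow> nat \<Rightarrow> nat \<Rightarrow> bool" where
  "valid t a j \<longleftrightarrow> j \<le> a \<and> a + m \<le> length t + j"

definition found :: "nat list \<Rightarrow> nat \<Rightarrow> nat \<Rightarrow> bool" where
  "found t a j \<longleftrightarrow> valid t a j \<and> hits t (a - j) j = length (probes j)"

text \<open>A window sticking out of the text is rejected before any comparison, hence the value
  0.\<close>

definition work :: "nat list \<Rightarrow> nat \<Rightarrow> nat \<Rightarrow> nat" where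
  "work t a j = (if valid t a j then hits t (a - j) j else 0)"

lemma length_probes: "length (probes j) \<le> m"
proof -
  have "length (probes j) \<le> length [0..<s]" unfolding probes_def length_map by (rule length_filter_le)
  then show ?thesis using s by simp
qed

lemma probes_less: "p \<in> set (probes j) \<Longrightarrow> p < m"
  using m by (auto simp: probes_def site_def)

definition keep :: "nat \<Rightarrow> state \<Rightarrow> state \<Rightarrow> bool" where
  "keep r st st' \<longleftrightarrow> mem st' = mem st \<and> (\<forall>i<r. regs st' i = regs st i)"

lemma ready_keep: "ready n st \<Longrightarrow> keep r st st' \<Longrightarrow> 8 \<le> r \<Longrightarrow> ready n st'"
  unfolding ready_def keep_def env_def by auto

section \<open>Runs of the search commands\<close>

context
  fixes S n :: nat and t :: "nat list"
  assumes S: "6 * m ^ 4 \<le> S" and n: "length t = n" "m < n" "n ^ 8 \<le> 2 ^ w"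
begin

lemma n_small: "4 * n + 4 < 2 ^ w"
proof -
  have n2: "2 \<le> n" using n m by simp
  have "4 * n + 4 < 2 ^ 7 * n" using n2 by simp
  also have "\<dots> \<le> n ^ 7 * n" using n2 by (intro mult_right_mono power_mono) auto
  also have "\<dots> = n ^ 8" by (simp flip: power_Suc2)
  finally show ?thesis using n by simp
qed

lemma ready_probes:
  assumes "ready n st" and "j < s" and "c \<le> length (probes j)"
  shows "mem st ((m + 1) * (1 + j) + c) = (if c < length (probes j) then Suc (probes j ! c) else 0)"
    and "(m + 1) * (1 + j) + c + 1 < 2 ^ w" and "(m + 1) * (1 + j) + c < S"
proof -
  have c: "c < m + 1" using assms(3) length_probes[of j] by linarith
  show "mem st ((m + 1) * (1 + j) + c) = (if c < length (probes j) then Suc (probes j ! c) else 0)"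
    using assms(1,2) c unfolding ready_def has_row_def by (auto simp: nth_map)
  have "(m + 1) * (1 + j) + (m + 1) = (m + 1) * (1 + Suc j)" by simp
  also have "\<dots> \<le> (m + 1) * (m + 1 + K)" using assms(2) s K by (intro mult_left_mono) auto
  finally show "(m + 1) * (1 + j) + c + 1 < 2 ^ w" "(m + 1) * (1 + j) + c < S"
    using c size_bound S by linarith+
qed

lemma length_cands: "length (cands y) \<le> m"
proof -
  have "length (cands y) \<le> length [0..<s]" unfolding cands_def by (rule length_filter_le)
  then show ?thesis using s by simp
qed

lemma ready_cands:
  assumes "ready n st" and "y < K" and "c \<le> length (cands y)"
  shows "mem st ((m + 1) * (m + 1 + y) + c) = (if c < length (cands y) then Suc (cands y ! c) else 0)"
    and "(m + 1) * (m + 1 + y) + c + 1 < 2 ^ w" and "(m + 1) * (m + 1 + y) + c < S"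
proof -
  have c: "c < m + 1" using assms(3) length_cands[of y] by linarith
  show "mem st ((m + 1) * (m + 1 + y) + c) = (if c < length (cands y) then Suc (cands y ! c) else 0)"
    using assms(1,2) c unfolding ready_def has_row_def by (auto simp: nth_map)
  have "(m + 1) * (m + 1 + y) + (m + 1) = (m + 1) * (m + 1 + Suc y)" by simp
  also have "\<dots> \<le> (m + 1) * (m + 1 + K)" using assms(2) by (intro mult_left_mono) auto
  finally show "(m + 1) * (m + 1 + y) + c + 1 < 2 ^ w" "(m + 1) * (m + 1 + y) + c < S"
    using c size_bound(1) S size_bound(2) by linarith+
qed

lemma wp_hash:
  assumes "ready n st" and "regs st 8 = a" and "a + l \<le> n"
  shows "wp S w t hash (\<lambda>k st'. k \<le> 20 * l + 20 \<and> keep 9 st st' \<and> regs st' 9 = key t a l \<and> out st' = out st) st"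
proof -
  define I where "I = (\<lambda>i (st'::state). keep 9 st st' \<and> out st' = out st \<and> regs st' 11 = a + l - i \<and>
    regs st' 9 = key t (a + l - i) i)"
  have env: "env (R n) code st" using assms(1) by (simp add: ready_def)
  have al: "a + l < 2 ^ w" using assms n_small by linarith
  have "wp S w t (While (Bin Less (Reg 8) (Reg 11))
           (Seq (Assign 11 (Bin Minus (Reg 11) (Const 1)))
                (Assign 9 (Bin Plus (Bin Modulo (Txt (Reg 11)) RM) (Bin Times RM (Reg 9))))))
      (\<lambda>k s'. k \<le> (\<Sum>i<l. 13 + cost (Bin Less (Reg 8) (Reg 11)) + 1) + cost (Bin Less (Reg 8) (Reg 11)) + 1 \<and> I l s')
      (st\<lparr>regs := (regs st)(9 := 0, 11 := a + l)\<rparr>)"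
  proof (rule wp_While, goal_cases)
    case 1
    show ?case by (simp add: I_def keep_def)
  next
    case (2 i st')
    define d where "d = a + l - Suc i"
    have d: "a + l - i = Suc d" "Suc d < 2 ^ w" "d < length t" "a < Suc d"
      unfolding d_def using 2(1) assms al n by linarith+
    have keep: "keep 9 st st'" "out st' = out st" using 2 by (simp_all add: I_def)
    have regs: "regs st' 8 = a" "regs st' 3 = M" "regs st' 11 = Suc d" "regs st' 9 = key t (Suc d) i"
      using 2 assms envD[OF env] d(1) by (simp_all add: I_def keep_def)
    \<comment> \<open>Partial keys stay below \<open>M ^ l = K\<close>, so Horner's rule does not
      overflow.\<close>
    have "M ^ Suc i \<le> K" unfolding K_def using M 2 by (intro power_increasing) auto
    then have "t ! d mod M + M * key t (Suc d) i < 2 ^ w"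
      using key_less[of t d "Suc i"] small unfolding key.simps by linarith
    moreover from this have "M * key t (Suc d) i < 2 ^ w" by linarith
    ultimately show ?case
      using d(2-4) w_pos keep
      by (simp add: regs I_def d_def[symmetric] keep_def)
  next
    case (3 st')
    have "regs st' 8 = a" "regs st' 11 = a"
      using 3 assms by (auto simp: I_def keep_def)
    then show ?case using w_pos by simp
  qed
  note A = wp_mono[OF this]
  show ?thesis
    unfolding hash_def
    using assms(2) al envD[OF env] w_pos
    apply (simp del: One_nat_def)
    apply (rule A)
    apply (auto simp: I_def)
    done
qed

text \<open>Stored probes are nonzero, so the cell finally reached contains 0 exactly if all probes
  succeeded. This is the test made by \<open>verify\<close> afterwards.\<close>

lemma wp_compare:
  assumes "ready n st" and "regs st 13 = i" and "regs st 14 = (m + 1) * (1 + j)" and "j < s" and "i + m \<le> n"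
  shows "wp S w t compare (\<lambda>k st'. k \<le> 30 * hits t i j + 30 \<and> keep 14 st st' \<and> out st' = out st \<and>
     mem st (regs st' 14) = (if hits t i j = length (probes j) then 0 else 1 + probes j ! hits t i j) \<and>
     regs st' 14 < S) st"
proof -
  define v where "v = hits t i j"
  define I where "I = (\<lambda>k (st'::state). keep 14 st st' \<and> out st' = out st \<and> regs st' 14 = (m + 1) * (1 + j) + k)"
  let ?e = "Bin BitAnd (Bin Less (Const 0) (Mem (Reg 14)))
             (Bin Equal
               (Txt (Bin Minus (Bin Plus (Reg 13) (Mem (Reg 14))) (Bin Less (Const 0) (Mem (Reg 14)))))
               (Mem (Bin Minus (Mem (Reg 14)) (Bin Less (Const 0) (Mem (Reg 14))))))"
  have v: "v \<le> length (probes j)" unfolding v_def hits_def by (rule length_takeWhile_le)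
  have env: "env (R n) code st" using assms(1) by (simp add: ready_def)
  note row = ready_probes[OF assms(1,4)]
  have pr: "probes j ! k < m" if "k < length (probes j)" for k
    by (rule probes_less[OF nth_mem[OF that]])
  have mS: "m \<le> S" using self_le_power[of m 4] m S by simp
  have cond: "safe S w t st' ?e \<and> eval w t st' ?e =
      (if k < length (probes j) \<and> t ! (i + probes j ! k) = code (probes j ! k) then 1 else 0)"
    if I: "I k st'" and k: "k \<le> length (probes j)" for k st'
  proof -
    have st': "mem st' = mem st" "regs st' 13 = i" "regs st' 14 = (m + 1) * (1 + j) + k"
      using I assms by (auto simp: I_def keep_def)
    have mS': "0 < S" using mS m by simp
    show ?thesis
    proof (cases "k < length (probes j)")
      case True
      have "i + Suc (probes j ! k) < 2 ^ w" "i + probes j ! k < length t"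
        using pr[OF True] assms(5) n n_small by auto
      then show ?thesis
        using True pr[OF True] mS row[of k] envD(9)[OF env pr[OF True]] w_pos
           word_minus[of 1 "i + Suc (probes j ! k)" w] word_minus[of 1 "Suc (probes j ! k)" w]
        by (simp add: st')
    next
      case False
      then have "k = length (probes j)" using k by simp
      \<comment> \<open>At the terminator the two addresses become \<open>i\<close> and 0, which
        must be in range for the test to be evaluated at all.\<close>
      moreover have "i < length t" "i < 2 ^ w" using assms n m n_small by auto
      ultimately show ?thesis
        using row[of k] mS' w_pos by (simp add: st')
    qed
  qed
  have "wp S w t (While ?e (Assign 14 (Bin Plus (Reg 14) (Const 1))))
    (\<lambda>k s'. k \<le> (\<Sum>i<v. 4 + cost ?e + 1) + cost ?e + 1 \<and> I v s') st"
  proof (rule wp_While, goal_cases)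
    case 1
    show ?case using assms by (simp add: I_def keep_def)
  next
    case (2 k st')
    have k: "k < length (probes j)" using 2 v by simp
    have "t ! (i + probes j ! k) = code (probes j ! k)" using 2(1) unfolding v_def by (rule hits_match)
    then have "safe S w t st' ?e \<and> eval w t st' ?e \<noteq> 0" using cond[OF 2(2)] k by (simp del: safe.simps eval.simps)
    moreover have "regs st' 14 + 1 < 2 ^ w"
      using 2(2) row(2)[OF less_imp_le[OF k]] by (simp only: I_def)
    then have "wp S w t (Assign 14 (Bin Plus (Reg 14) (Const 1))) (\<lambda>ka s'. ka \<le> 4 \<and> I (Suc k) s') st'"
      using 2(2) w_pos by (simp add: I_def keep_def)
    ultimately show ?case by blast
  next
    case (3 st')
    have "\<not> (v < length (probes j) \<and> t ! (i + probes j ! v) = code (probes j ! v))"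
      using nth_length_takeWhile[of "\<lambda>p. t ! (i + p) = code p" "probes j"] unfolding v_def hits_def by auto
    then show ?case using cond[OF 3 v] by (simp del: safe.simps eval.simps)
  qed
  then show ?thesis
    unfolding compare_def
  proof (rule wp_mono, goal_cases)
    case (1 k s')
    then show ?case using row[OF v] v by (auto simp: I_def v_def)
  qed
qed

lemma wp_verify:
  assumes "ready n st" and "regs st 8 = a" and "regs st 10 < S" and "mem st (regs st 10) = Suc j" and "j < s"
    and "a \<le> n"
  shows "wp S w t verify (\<lambda>k st'. k \<le> 30 * work t a j + 100 \<and> keep 12 st st' \<and>
     set (out st') = set (out st) \<union> (if found t a j then {a - j} else {})) st"
proof -
  have env: "env (R n) code st" using assms(1) by (simp add: ready_def)
  have bd: "Suc j < 2 ^ w" "a + m < 2 ^ w" "Suc a < 2 ^ w" "Suc (n + j) < 2 ^ w" "m + 1 < 2 ^ w" "a < 2 ^ w"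
    using assms s n n_small by linarith+
  have bd2: "(m + 1) * (1 + j) < 2 ^ w" "(m + 1) * (1 + j) < S"
    using ready_probes(2,3)[OF assms(1,5), of 0] by auto
  have eq: "a + m < Suc (n + j) \<longleftrightarrow> a + m \<le> n + j" "j < Suc a \<longleftrightarrow> j \<le> a" by auto
  show ?thesis
  proof (cases "valid t a j")
    case True
    then have ja: "j \<le> a" "a + m \<le> n + j" using n by (auto simp: valid_def)
    let ?s = "st\<lparr>regs := (regs st)(12 := j, 13 := a - j, 14 := (m + 1) * (1 + j))\<rparr>"
    have "wp S w t compare (\<lambda>k st'. k \<le> 30 * hits t (a - j) j + 30 \<and> keep 14 ?s st' \<and> out st' = out ?s \<and>
     mem ?s (regs st' 14) = (if hits t (a - j) j = length (probes j) then 0 else 1 + probes j ! hits t (a - j) j) \<and>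
     regs st' 14 < S) ?s"
    proof (rule wp_compare)
      show "ready n ?s" by (rule ready_keep[OF assms(1), of 8]) (simp_all add: keep_def)
    qed (use ja assms in auto)
    note A = wp_mono[OF this]
    show ?thesis
      unfolding verify_def row_start_def
      using assms(2-5) bd bd2 w_pos envD(1-8)[OF env] ja word_minus[of 1 "Suc j" w] word_minus[OF ja(1) bd(6)]
      apply (simp del: One_nat_def mult_Suc mult_Suc_right distrib_left split del: if_split)
      apply (rule A)
      subgoal for k st' by (cases "hits t (a - j) j = length (probes j)")
          (simp_all add: keep_def found_def True work_def)
      done
  next
    case False
    then have "\<not> (j \<le> a \<and> a + m \<le> n + j)" using n by (auto simp: valid_def)
    then show ?thesis
      unfolding verify_def
      using assms(2-5) bd w_pos envD(1-8)[OF env] word_minus[of 1 "Suc j" w]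
      by (auto simp: keep_def found_def False work_def)
  qed
qed

end
definition block_cost :: "nat list \<Rightarrow> nat \<Rightarrow> nat" where
  "block_cost t a = 20 * l + 100 + (\<Sum>j | j < s \<and> cand (key t a l) j. 30 * work t a j + 110)"

definition block_out :: "nat list \<Rightarrow> nat \<Rightarrow> nat set" where
  "block_out t a = {a - j |j. j < s \<and> cand (key t a l) j \<and> found t a j}"

definition blocks :: "nat \<Rightarrow> nat" where
  "blocks n = (n - l) div s + 1"

lemma blocks: "l \<le> n \<Longrightarrow> k * s + l \<le> n \<longleftrightarrow> k < blocks n"
  using s by (simp add: blocks_def less_Suc_eq_le less_eq_div_iff_mult_less_eq le_diff_conv2)

lemma sum_cands: "(\<Sum>i<length (cands y). f (cands y ! i)) = (\<Sum>j | j < s \<and> cand y j. f j :: nat)"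
proof -
  have "(\<Sum>i<length (cands y). f (cands y ! i)) = sum_list (map f (cands y))"
    by (simp add: sum_list_sum_nth atLeast0LessThan)
  also have "\<dots> = sum f (set (cands y))"
    by (rule sum_list_distinct_conv_sum_set) (simp add: cands_def)
  also have "set (cands y) = {j. j < s \<and> cand y j}" by (auto simp: cands_def)
  finally show ?thesis .
qed

context
  fixes S n :: nat and t :: "nat list"
  assumes S: "6 * m ^ 4 \<le> S" and n: "length t = n" "m < n" "n ^ 8 \<le> 2 ^ w"
begin

lemma wp_scan:
  assumes "ready n st" and "regs st 8 = a" and "regs st 10 = (m + 1) * (m + 1 + y)" and "y < K" and "a \<le> n"
  shows "wp S w t scan (\<lambda>k st'. k \<le> (\<Sum>j | j < s \<and> cand y j. 30 * work t a j + 110) + 3 \<and> keep 10 st st' \<and>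
     set (out st') = set (out st) \<union> {a - j |j. j < s \<and> cand y j \<and> found t a j}) st"
proof -
  define L where "L = cands y"
  have setL: "set L = {j. j < s \<and> cand y j}" by (auto simp: L_def cands_def)
  note row = ready_cands[OF S n assms(1,4), folded L_def]
  define I where "I = (\<lambda>k (st'::state). keep 10 st st' \<and> regs st' 10 = (m + 1) * (m + 1 + y) + k \<and>
    set (out st') = set (out st) \<union> {a - j |j. j \<in> set (take k L) \<and> found t a j})"
  have "wp S w t scan (\<lambda>k st'. k \<le> (\<Sum>i<length L. 30 * work t a (L ! i) + 104 + cost (Mem (Reg 10)) + 1) +
      cost (Mem (Reg 10)) + 1 \<and> I (length L) st') st"
    unfolding scan_def
  proof (rule wp_While, goal_cases)
    case 1
    show ?case using assms by (simp add: I_def keep_def)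
  next
    case (2 k st')
    have r: "ready n st'" using 2(2) assms(1) by (auto simp: I_def intro: ready_keep)
    have mem: "mem st' (regs st' 10) = Suc (L ! k)" and addr: "regs st' 10 < S" "regs st' 10 + 1 < 2 ^ w"
      using 2 row[of k] by (simp_all only: I_def keep_def less_imp_le if_True)
    have "L ! k \<in> set L" using 2(1) by simp
    then have j: "L ! k < s" using setL by blast
    have a: "regs st' 8 = a" using 2(2) assms by (simp add: I_def keep_def)
    note V = wp_verify[OF S n r a addr(1) mem j assms(5)]
    have take: "set (take (Suc k) L) = insert (L ! k) (set (take k L))"
      using 2(1) by (simp add: take_Suc_conv_app_nth)
    have "wp S w t (Seq verify (Assign 10 (Bin Plus (Reg 10) (Const 1))))
       (\<lambda>ka st''. ka \<le> 30 * work t a (L ! k) + 104 \<and> I (Suc k) st'') st'"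
      unfolding wp_Seq
    proof (rule wp_mono[OF V], goal_cases)
      case (1 k' s')
      have "keep 10 st s'" using 1 2(2) unfolding I_def keep_def by auto
      then have "keep 10 st (s'\<lparr>regs := (regs s')(10 := v)\<rparr>)" for v by (simp add: keep_def)
      moreover have "regs s' 10 = regs st' 10" using 1 by (simp add: keep_def)
      moreover have "set (out s') = set (out st) \<union> {a - j |j. j \<in> set (take (Suc k) L) \<and> found t a j}"
        unfolding take using 1 2(2) unfolding I_def by auto
      moreover have "regs st' 10 = (m + 1) * (m + 1 + y) + k" using 2(2) by (simp only: I_def)
      ultimately show ?case
        using 1 addr w_pos by (simp add: I_def)
    qed
    then show ?case using mem addr by simp
  next
    case (3 st')
    then show ?case using row[of "length L"] by (simp add: I_def keep_def)
  qed
  then show ?thesis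
  proof (rule wp_mono, goal_cases)
    case (1 k st')
    have "(\<Sum>i<length L. 30 * work t a (L ! i) + 104 + cost (Mem (Reg 10)) + 1) \<le>
       (\<Sum>i<length L. 30 * work t a (L ! i) + 110)" by (intro sum_mono) simp
    also have "\<dots> = (\<Sum>j | j < s \<and> cand y j. 30 * work t a j + 110)"
      unfolding L_def by (rule sum_cands)
    finally have "k \<le> (\<Sum>j | j < s \<and> cand y j. 30 * work t a j + 110) + 3"
      using 1 unfolding cost.simps by linarith
    then show ?case using 1 setL by (simp add: I_def)
  qed
qed

lemma wp_search:
  assumes "ready n st" and "out st = []"
  shows "wp S w t search (\<lambda>k st'. k \<le> (\<Sum>b<blocks n. block_cost t (b * s)) + 20 \<and>
     set (out st') = (\<Union>b<blocks n. block_out t (b * s))) st"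
proof -
  define I where "I = (\<lambda>b (st'::state). ready n st' \<and> regs st' 8 = b * s \<and>
    set (out st') = (\<Union>b'<b. block_out t (b' * s)))"
  let ?e = "Bin Less (Bin Plus (Reg 8) Rl) (Bin Plus Rn (Const 1))"
  have ln: "l \<le> n" using l_le n by simp
  have ns: "4 * n + 4 < 2 ^ w" by (rule n_small[OF S n])
  have cond: "safe S w t st' ?e \<and> eval w t st' ?e = (if b < blocks n then 1 else 0)"
    if "I b st'" and "b \<le> blocks n" for b st'
  proof -
    have env: "env (R n) code st'" using that by (simp add: I_def ready_def)
    \<comment> \<open>The last test is made at a start behind the last block; it is still at most
      \<open>2 * n\<close>, so nothing overflows.\<close>
    have "b * s \<le> blocks n * s" using that by (intro mult_right_mono) auto
    also have "\<dots> \<le> (n - l) + s" by (simp add: blocks_def)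
    also have "\<dots> \<le> 2 * n" using s n by simp
    finally have "b * s + l < 2 ^ w" "n + 1 < 2 ^ w" using ns ln by linarith+
    moreover have "regs st' 8 = b * s" using that by (simp add: I_def)
    ultimately show ?thesis
      using envD(1-8)[OF env] w_pos blocks[OF ln, of b] by (simp add: less_Suc_eq_le)
  qed
  \<comment> \<open>Of the budget of each block, 20 steps are set aside for the loop test.\<close>
  have "wp S w t (While ?e (Seq hash (Seq (Assign 10 (row_start (Bin Plus Rm (Const 1)) (Reg 9)))
        (Seq scan (Assign 8 (Bin Plus (Reg 8) Rs))))))
     (\<lambda>k s'. k \<le> (\<Sum>b<blocks n. (block_cost t (b * s) - 20) + cost ?e + 1) + cost ?e + 1 \<and> I (blocks n) s')
     (st\<lparr>regs := (regs st)(8 := 0)\<rparr>)"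
  proof (rule wp_While, goal_cases)
    case 1
    show ?case using assms by (auto simp: I_def ready_def env_def)
  next
    case (2 b st0)
    have bl: "b * s + l \<le> n" using blocks[OF ln] 2(1) by simp
    define a where "a = b * s"
    have st0: "ready n st0" "regs st0 8 = a" "set (out st0) = (\<Union>b'<b. block_out t (b' * s))"
      using 2 by (simp_all add: I_def a_def)
    have al: "a + l \<le> n" "a \<le> n" using bl by (simp_all add: a_def)
    let ?y = "key t a l"
    have y: "?y < K" using key_less by (simp add: K_def)
    have bd: "(m + 1) * (m + 1 + ?y) < 2 ^ w"
      using ready_cands(2)[OF S n st0(1) y, of 0] by simp
    have "(m + 1 + ?y) * 1 \<le> (m + 1 + ?y) * (m + 1)" by (intro mult_left_mono) auto
    then have bd1: "m + 1 + ?y < 2 ^ w" "m + 1 < 2 ^ w" using bd by (simp_all add: mult.commute)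
    have as: "a + s < 2 ^ w" using al s n ns by linarith
    have "wp S w t (Seq hash (Seq (Assign 10 (row_start (Bin Plus Rm (Const 1)) (Reg 9)))
        (Seq scan (Assign 8 (Bin Plus (Reg 8) Rs))))) (\<lambda>k s'. k \<le> block_cost t (b * s) - 20 \<and> I (Suc b) s') st0"
      unfolding wp_Seq
    proof (rule wp_mono[OF wp_hash[OF S n st0(1,2) al(1)]], goal_cases)
      case (1 k1 st1)
      have r1: "ready n st1" using 1 st0 by (auto intro: ready_keep)
      have 9: "regs st1 9 = ?y" "regs st1 8 = a" "regs st1 1 = m"
        using 1 st0 envD(2)[of n st1] r1 by (simp_all add: keep_def ready_def)
      let ?st2 = "st1\<lparr>regs := (regs st1)(10 := (m + 1) * (m + 1 + ?y))\<rparr>"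
      have r2: "ready n ?st2" by (rule ready_keep[OF r1, of 8]) (simp_all add: keep_def)
      have e: "eval w t st1 (row_start (Bin Plus Rm (Const 1)) (Reg 9)) = (m + 1) * (m + 1 + ?y)"
         "safe S w t st1 (row_start (Bin Plus Rm (Const 1)) (Reg 9))"
         "cost (row_start (Bin Plus Rm (Const 1)) (Reg 9)) = 9"
        using 9 bd bd1 w_pos by (simp_all add: row_start_def)
      have "wp S w t scan (\<lambda>k. wp S w t (Assign 8 (Bin Plus (Reg 8) Rs))
         (\<lambda>k' s'. k1 + (10 + (k + k')) \<le> block_cost t (b * s) - 20 \<and> I (Suc b) s')) ?st2"
      proof (rule wp_mono[OF wp_scan[OF r2 _ _ y al(2)]], goal_cases)
        case (3 k3 st3)
        have r3: "ready n st3" using 3 r2 by (auto intro: ready_keep)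
        have 8: "regs st3 8 = a" "regs st3 6 = s"
          using 3 9 envD(8)[of n st3] r3 by (simp_all add: keep_def ready_def)
        have "ready n (st3\<lparr>regs := (regs st3)(8 := v)\<rparr>)" for v
          by (rule ready_keep[OF r3, of 8]) (simp_all add: keep_def)
        moreover have "set (out st3) = (\<Union>b'<Suc b. block_out t (b' * s))"
          using 3 1 st0(3) by (auto simp: block_out_def a_def lessThan_Suc)
        moreover have "k1 + (10 + (k3 + 4)) \<le> block_cost t (b * s) - 20"
          using 1 3 by (simp add: block_cost_def a_def)
        ultimately show ?case
          using 8 as w_pos by (simp add: I_def a_def add.commute)
      qed (use 9 in auto)
      then show ?case using e by simp
    qed
    then show ?case using cond[OF 2(2)] 2(1) by (simp del: safe.simps eval.simps)
  next
    case (3 st')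
    then show ?case using cond[OF 3] by (simp del: safe.simps eval.simps)
  qed
  then have "wp S w t (While ?e (Seq hash (Seq (Assign 10 (row_start (Bin Plus Rm (Const 1)) (Reg 9)))
        (Seq scan (Assign 8 (Bin Plus (Reg 8) Rs))))))
     (\<lambda>k s'. k \<le> (\<Sum>b<blocks n. block_cost t (b * s)) + 8 \<and> I (blocks n) s')
     (st\<lparr>regs := (regs st)(8 := 0)\<rparr>)"
  proof (rule wp_mono, goal_cases)
    case (1 k s')
    have "(\<Sum>b<blocks n. (block_cost t (b * s) - 20) + cost ?e + 1) \<le> (\<Sum>b<blocks n. block_cost t (b * s))"
      by (intro sum_mono) (simp add: block_cost_def)
    then show ?case using 1 unfolding cost.simps by linarith
  qed
  note A = wp_mono[OF this]
  show ?thesis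
    unfolding search_def using w_pos
    apply (simp del: One_nat_def)
    apply (rule A)
    apply (simp add: I_def)
    done
qed

end

section \<open>Correctness of the reported positions\<close>

lemma occurrences_iff:
  "i \<in> occurrences x t \<longleftrightarrow> i + m \<le> length t \<and> (\<forall>p<m. code p = \<sigma> \<or> t ! (i + p) = code p)"
    if "set t \<subseteq> {..<\<sigma>}"
proof -
  have corr: "corr (Some (t ! (i + p))) (x ! p) \<longleftrightarrow> code p = \<sigma> \<or> t ! (i + p) = code p"
    if "p < m" for p
    using code_wild[OF that] by (cases "x ! p") (auto simp: corr_def code_def)
  show ?thesis
  proof (cases "i + m \<le> length t")
    case True
    then have "min (length t - i) m = m" "min m (length t - i) = m" by auto
    with True have "i \<in> occurrences x t \<longleftrightarrow> (\<forall>p<m. corr (Some (t ! (i + p))) (x ! p))"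
      by (auto simp: occurrences_def matches_def len simp del: min_less_iff_conj)
    then show ?thesis using True corr by blast
  qed (simp add: occurrences_def len)
qed

lemma hits_all_iff:
  "hits t i j = length (probes j) \<longleftrightarrow> (\<forall>p\<in>set (probes j). t ! (i + p) = code p)"
proof
  assume h: "hits t i j = length (probes j)"
  show "\<forall>p\<in>set (probes j). t ! (i + p) = code p"
  proof
    fix p assume "p \<in> set (probes j)"
    then obtain k where "k < length (probes j)" "p = probes j ! k" by (metis in_set_conv_nth)
    then show "t ! (i + p) = code p" using hits_match[of k t i j] h by simp
  qed
next
  assume "\<forall>p\<in>set (probes j). t ! (i + p) = code p"
  then have "takeWhile (\<lambda>p. t ! (i + p) = code p) (probes j) = probes j"
    by (simp add: takeWhile_eq_all_conv)
  then show "hits t i j = length (probes j)" by (simp only: hits_def)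
qed

lemma probes_cover:
  assumes "p < m" and "code p \<noteq> \<sigma>" and "j < s" and "p \<le> j \<or> j + l \<le> p"
  shows "p \<in> set (probes j)"
proof -
  have jl: "j + l \<le> m" using assms(3) s by linarith
  \<comment> \<open>The inverse of \<open>site j\<close>: positions up to \<open>j\<close> are
    reached after wrapping around the end of the pattern, those from \<open>j + l\<close> on before
    it.\<close>
  define i where "i = (if p \<le> j then m - j - l + p else p - j - l)"
  have "i < s" using assms s jl l1 unfolding i_def by auto
  moreover have "site j i = p"
  proof (cases "p \<le> j")
    case True
    then have "i + j + l = m + p" using jl by (simp add: i_def)
    then show ?thesis using assms(1) by (simp add: site_def)
  next
    case False
    then have "i + j + l = p" using assms(4) by (simp add: i_def)
    then show ?thesis using assms(1) by (simp add: site_def)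
  qed
  ultimately show ?thesis using assms(2) unfolding probes_def by force
qed

lemma probes_wild: "p \<in> set (probes j) \<Longrightarrow> code p \<noteq> \<sigma>"
  by (auto simp: probes_def)

text \<open>Probes compare exact letters outside the block and at \<open>j\<close>; the candidate
  test compares residues inside the block. Block positions other than \<open>j\<close> exist only if
  \<open>l > 1\<close>, and then \<open>M = \<sigma>\<close>, so residues determine letters.\<close>

lemma cand_found_iff:
  assumes t: "set t \<subseteq> {..<\<sigma>}" and j: "j < s" and i: "i + m \<le> length t"
  shows "cand (key t (i + j) l) j \<and> found t (i + j) j \<longleftrightarrow> i \<in> occurrences x t"
proof -
  have valid: "valid t (i + j) j" using i by (simp add: valid_def)
  have cand: "cand (key t (i + j) l) j \<longleftrightarrow>
      (\<forall>r<l. code (j + r) = \<sigma> \<or> code (j + r) mod M = t ! (i + (j + r)) mod M)"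
    unfolding cand_def by (auto simp: key_digit add.assoc)
  show ?thesis
  proof
    assume A: "cand (key t (i + j) l) j \<and> found t (i + j) j"
    have "code p = \<sigma> \<or> t ! (i + p) = code p" if p: "p < m" for p
    proof (cases "code p = \<sigma> \<or> p \<le> j \<or> j + l \<le> p")
      case True
      then show ?thesis
        using A probes_cover[OF p _ j] by (auto simp: found_def hits_all_iff)
    next
      case False
      then obtain r where r: "p = j + r" "0 < r" "r < l" by (metis le_add_diff_inverse less_diff_conv2
            linorder_not_le nat_less_le add.commute add_diff_cancel_left' less_imp_le_nat zero_less_diff)
      then have "M = \<sigma>" using l_eq_1 by fastforce
      moreover have "code p mod M = t ! (i + p) mod M" using A False r cand by blast
      moreover have "code p < \<sigma>" using False code_le[OF p] by simp
      moreover have "t ! (i + p) < \<sigma>" using t i p by (metis add_less_cancel_left lessThan_iff nth_mem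
            order_less_le_trans subsetD)
      ultimately show ?thesis by simp
    qed
    then show "i \<in> occurrences x t" using occurrences_iff[OF t] i by blast
  next
    assume "i \<in> occurrences x t"
    then have all: "code p = \<sigma> \<or> t ! (i + p) = code p" if "p < m" for p
      using occurrences_iff[OF t] that by blast
    have "j + r < m" if "r < l" for r using that j s by linarith
    then have "cand (key t (i + j) l) j" using all unfolding cand by metis
    moreover have "hits t i j = length (probes j)"
      unfolding hits_all_iff using all probes_less probes_wild by blast
    ultimately show "cand (key t (i + j) l) j \<and> found t (i + j) j"
      using valid by (simp add: found_def)
  qed
qed

lemma block_out_correct:
  assumes t: "set t \<subseteq> {..<\<sigma>}" and n: "m < length t"
  shows "(\<Union>b<blocks (length t). block_out t (b * s)) = occurrences x t"
proof (intro equalityI subsetI)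
  fix i assume "i \<in> (\<Union>b<blocks (length t). block_out t (b * s))"
  then obtain b j where "b < blocks (length t)" and i: "i = b * s - j" "j < s"
    "cand (key t (b * s) l) j" "found t (b * s) j" by (auto simp: block_out_def)
  then have "j \<le> b * s" "b * s + m \<le> length t + j" by (auto simp: found_def valid_def)
  with i have "b * s = i + j" "i + m \<le> length t" by linarith+
  then show "i \<in> occurrences x t" using cand_found_iff[OF t i(2), of i] i by simp
next
  fix i assume occ: "i \<in> occurrences x t"
  then have im: "i + m \<le> length t" using occurrences_iff[OF t] by blast
  \<comment> \<open>\<open>i / s\<close> rounded up, so that \<open>b * s\<close> is the only
    multiple of \<open>s\<close> among \<open>i, ..., i + s - 1\<close>. A block starting there ends
    within the window, since \<open>s + l = m + 1\<close>.\<close>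
  define b where "b = (i + (s - 1)) div s"
  define j where "j = b * s - i"
  have "b * s \<le> i + (s - 1)" unfolding b_def by (rule div_times_less_eq_dividend)
  moreover have "i + (s - 1) < b * s + s"
    unfolding b_def using dividend_less_div_times[of s "i + (s - 1)"] s by simp
  ultimately have j: "j < s" "b * s = i + j" and bs: "b * s + l \<le> i + m"
    using s unfolding j_def by linarith+
  have "b < blocks (length t)" using blocks[of "length t" b] bs im l_le n by simp
  moreover have "i \<in> block_out t (b * s)"
    using cand_found_iff[OF t j(1) im] occ j unfolding block_out_def by force
  ultimately show "i \<in> (\<Union>b<blocks (length t). block_out t (b * s))" by blast
qed

end

section \<open>Random texts\<close>

text \<open>Splitting off the first letter turns the event into a product set, whose probability
  factorizes by independence.\<close>

lemma prob_replicate_pmf: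
  fixes p :: "nat pmf"
  shows "measure_pmf.prob (replicate_pmf n p) {t. \<forall>i<n. t ! i \<in> B i} = (\<Prod>i<n. measure_pmf.prob p (B i))"
proof (induction n arbitrary: B)
  case (Suc n)
  have eq: "replicate_pmf (Suc n) p = map_pmf (\<lambda>(y, ys). y # ys) (pair_pmf p (replicate_pmf n p))"
    by (simp add: pair_pmf_def map_bind_pmf)
  have vim: "(\<lambda>(y, ys). y # ys) -` {t. \<forall>i<Suc n. t ! i \<in> B i} = B 0 \<times> {t. \<forall>i<n. t ! i \<in> B (Suc i)}"
    by (auto simp: less_Suc_eq_0_disj)
  show ?case
    unfolding eq measure_map_pmf vim
    by (subst measure_pmf_prob_product) (simp_all add: Suc prod.lessThan_Suc_shift del: prod.lessThan_Suc)
qed simp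

lemma prob_random_text:
  assumes "\<sigma> > 0" and "D \<subseteq> {..<n}"
  shows "measure_pmf.prob (random_text \<sigma> n) {t. \<forall>p\<in>D. t ! p \<in> B p} =
    (\<Prod>p\<in>D. real (card ({..<\<sigma>} \<inter> B p)) / real \<sigma>)"
proof -
  \<comment> \<open>Positions outside \<open>D\<close> are unconstrained and contribute a factor
    1.\<close>
  let ?B = "\<lambda>p. if p \<in> D then B p else UNIV"
  have ne: "finite {..<\<sigma>}" "{..<\<sigma>} \<noteq> {}" using assms by auto
  have "{t. \<forall>p\<in>D. t ! p \<in> B p} = {t. \<forall>p<n. t ! p \<in> ?B p}" using assms(2) by auto
  then have "measure_pmf.prob (random_text \<sigma> n) {t. \<forall>p\<in>D. t ! p \<in> B p} =
      (\<Prod>p<n. measure_pmf.prob (pmf_of_set {..<\<sigma>}) (?B p))"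
    unfolding random_text_def by (simp only: prob_replicate_pmf)
  also have "\<dots> = (\<Prod>p\<in>D. measure_pmf.prob (pmf_of_set {..<\<sigma>}) (?B p))"
    using assms(2) by (intro prod.mono_neutral_right) auto
  also have "\<dots> = (\<Prod>p\<in>D. real (card ({..<\<sigma>} \<inter> B p)) / real \<sigma>)"
    using ne by (intro prod.cong) (auto simp: measure_pmf_of_set)
  finally show ?thesis .
qed

lemma set_random_text:
  "\<sigma> > 0 \<Longrightarrow> set_pmf (random_text \<sigma> n) = {t. set t \<subseteq> {..<\<sigma>} \<and> length t = n}"
  unfolding random_text_def set_replicate_pmf by (subst set_pmf_of_set) (auto simp: lists_eq_set)

lemma integrable_random_text:
  fixes f :: "nat list \<Rightarrow> real"
  shows "\<sigma> > 0 \<Longrightarrow> integrable (measure_pmf (random_text \<sigma> n)) f"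
  by (rule integrable_measure_pmf_finite) (simp add: set_random_text finite_lists_length_eq)

text \<open>By convexity of the exponential function, \<open>\<rho> ^ c\<close> lies below the chord
  through the exponents 0 and \<open>l\<close>. Raising the weight \<open>c / l\<close> of
  \<open>\<rho> ^ l\<close> to 1 gives a bound linear in the number \<open>l - c\<close> of
  wildcards in a block.\<close>

lemma power_le_chord:
  fixes \<rho> :: real
  assumes "0 < \<rho>" and "c \<le> l" and "l > 0"
  shows "\<rho> ^ c \<le> \<rho> ^ l + real (l - c) / real l"
proof -
  define u where "u = real c / real l"
  have u: "0 \<le> u" "u \<le> 1" using assms by (auto simp: u_def)
  have "exp ((1 - u) *\<^sub>R 0 + u *\<^sub>R (real l * ln \<rho>)) \<le> (1 - u) * exp 0 + u * exp (real l * ln \<rho>)"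
    using convex_onD[OF exp_convex, of u 0 "real l * ln \<rho>"] u by simp
  also have "(1 - u) *\<^sub>R 0 + u *\<^sub>R (real l * ln \<rho>) = real c * ln \<rho>"
    using assms by (simp add: u_def)
  also have "exp (real c * ln \<rho>) = \<rho> ^ c" using assms by (simp add: exp_of_nat_mult)
  also have "exp (real l * ln \<rho>) = \<rho> ^ l" using assms by (simp add: exp_of_nat_mult)
  also have "(1 - u) * exp 0 + u * \<rho> ^ l \<le> (1 - u) + \<rho> ^ l"
    using u assms mult_right_mono[of u 1 "\<rho> ^ l"] by simp
  also have "1 - u = real (l - c) / real l" using assms by (simp add: u_def field_simps of_nat_diff)
  finally show ?thesis by simp
qed

context wildcard_pattern
begin

section \<open>Expected number of candidates of a block\<close>

definition \<rho> :: real where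
  "\<rho> = (if M = \<sigma> then 1 / real \<sigma> else min 1 (2 / real m))"

definition fixed :: "nat \<Rightarrow> nat set" where
  "fixed j = {r. r < l \<and> code (j + r) \<noteq> \<sigma>}"

lemma \<rho>: "0 < \<rho>" "\<rho> \<le> 1"
  using \<sigma> m by (auto simp: \<rho>_def)

text \<open>For \<open>M = \<sigma>\<close> the left side is \<open>1 / K\<close> with
  \<open>K \<ge> m\<close>; otherwise \<open>l = 1\<close>.\<close>

lemma \<rho>_power: "\<rho> ^ l \<le> 2 / real m"
proof (cases "M = \<sigma>")
  case True
  then have "\<rho> ^ l = 1 / real K" by (simp add: \<rho>_def K_def power_one_over)
  also have "\<dots> \<le> 1 / real m" using K m by (intro divide_left_mono) auto
  also have "\<dots> \<le> 2 / real m" by (intro divide_right_mono) auto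
  finally show ?thesis .
next
  case False
  then show ?thesis using l_eq_1 by (simp add: \<rho>_def)
qed

text \<open>If \<open>M = m < \<sigma>\<close>, division by \<open>m\<close> is injective on a
  residue class, which thus has at most \<open>\<sigma> div m + 1\<close> members; this is at most
  \<open>2 * \<sigma> / m\<close>.\<close>

lemma card_residue: "real (card ({..<\<sigma>} \<inter> {c. c mod M = d mod M})) / real \<sigma> \<le> \<rho>"
proof (cases "M = \<sigma>")
  case True
  have "{..<\<sigma>} \<inter> {c. c mod M = d mod M} \<subseteq> {d mod M}" using True by auto
  from card_mono[OF _ this] show ?thesis using True by (simp add: \<rho>_def divide_right_mono)
next
  case False
  then have Mm: "M = m" "m < \<sigma>" using M by (auto simp: M_def min_def split: if_splits)
  let ?A = "{..<\<sigma>} \<inter> {c. c mod M = d mod M}"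
  have "inj_on (\<lambda>c. c div m) ?A"
    by (rule inj_onI) (metis (mono_tags, lifting) IntD2 Mm(1) div_mult_mod_eq mem_Collect_eq)
  then have "card ?A = card ((\<lambda>c. c div m) ` ?A)" by (simp add: card_image)
  also have "\<dots> \<le> card {..\<sigma> div m}" by (intro card_mono) (auto intro: div_le_mono)
  finally have "real (card ?A) \<le> real (\<sigma> div m) + 1" by simp
  also have "\<dots> \<le> real \<sigma> / real m + real \<sigma> / real m"
    using Mm m by (intro add_mono of_nat_div_le_of_nat) (simp add: field_simps)
  finally have "real (card ?A) / real \<sigma> \<le> 2 / real m"
    using m Mm by (simp add: field_simps)
  moreover have "real (card ?A) / real \<sigma> \<le> 1"
    using card_mono[of "{..<\<sigma>}" ?A] \<sigma> by simp
  ultimately show ?thesis using False by (simp add: \<rho>_def)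
qed

lemma card_wild: "card {p. p < m \<and> code p = \<sigma>} = g"
proof -
  have "g = length (filter ((=) None) x)" using g by (simp add: count_list_eq_length_filter)
  also have "\<dots> = card {p. p < m \<and> None = x ! p}" by (simp add: length_filter_conv_card len)
  also have "{p. p < m \<and> None = x ! p} = {p. p < m \<and> code p = \<sigma>}"
    using code_wild by auto
  finally show ?thesis ..
qed

text \<open>Double counting of the pairs of an offset \<open>j\<close> and an \<open>r < l\<close>
  with a wildcard at \<open>j + r\<close>: each \<open>r\<close> admits at most \<open>g\<close>
  offsets. The total \<open>l * g\<close> cancels the denominator of the chord bound, and the
  \<open>s\<close> terms \<open>\<rho> ^ l\<close> add up to at most 2.\<close>

lemma sum_rho: "(\<Sum>j<s. \<rho> ^ card (fixed j)) \<le> real g + 2"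
proof -
  define W where "W = {p. p < m \<and> code p = \<sigma>}"
  have fin: "finite W" by (simp add: W_def)
  have fixed: "l - card (fixed j) = (\<Sum>r<l. if j + r \<in> W then 1 else 0)" if "j < s" for j
  proof -
    have "{..<l} = fixed j \<union> {r. r < l \<and> j + r \<in> W}"
      using that s by (auto simp: fixed_def W_def)
    moreover have "fixed j \<inter> {r. r < l \<and> j + r \<in> W} = {}" by (auto simp: fixed_def W_def)
    ultimately have "l = card (fixed j) + card {r. r < l \<and> j + r \<in> W}"
      by (metis card_Un_disjoint card_lessThan finite_Un finite_lessThan)
    moreover have "card {r. r < l \<and> j + r \<in> W} = (\<Sum>r<l. if j + r \<in> W then 1 else 0)"
      by (simp add: sum.If_cases Int_def)
    ultimately show ?thesis by linarith
  qed
  have le: "card (fixed j) \<le> l" for j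
    using card_mono[of "{..<l}" "fixed j"] by (auto simp: fixed_def)
  have shift: "(\<Sum>j<s. if j + r \<in> W then 1 else 0 :: nat) \<le> g" for r
  proof -
    have "(\<Sum>j<s. if j + r \<in> W then 1 else 0 :: nat) = card {j. j < s \<and> j + r \<in> W}"
      by (simp add: sum.If_cases Int_def)
    also have "\<dots> = card ((\<lambda>j. j + r) ` {j. j < s \<and> j + r \<in> W})"
      by (subst card_image) (auto simp: inj_on_def)
    also have "\<dots> \<le> card W" by (intro card_mono fin) auto
    finally show ?thesis using card_wild by (simp add: W_def)
  qed
  have "(\<Sum>j<s. l - card (fixed j)) = (\<Sum>j<s. \<Sum>r<l. if j + r \<in> W then 1 else 0)"
    by (intro sum.cong refl) (use fixed in simp)
  also have "\<dots> = (\<Sum>r<l. \<Sum>j<s. if j + r \<in> W then 1 else 0)" by (rule sum.swap)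
  also have "\<dots> \<le> (\<Sum>r<l. g)" by (intro sum_mono shift)
  finally have total: "(\<Sum>j<s. l - card (fixed j)) \<le> l * g" by simp
  have "(\<Sum>j<s. \<rho> ^ card (fixed j)) \<le> (\<Sum>j<s. \<rho> ^ l + real (l - card (fixed j)) / real l)"
    using le \<rho> l1 by (intro sum_mono power_le_chord) auto
  also have "\<dots> = real s * \<rho> ^ l + real (\<Sum>j<s. l - card (fixed j)) / real l"
    by (simp add: sum.distrib sum_divide_distrib)
  also have "real s * \<rho> ^ l \<le> real m * (2 / real m)"
    using s \<rho> by (intro mult_mono \<rho>_power) auto
  also have "\<dots> = 2" using m by simp
  also have "real (\<Sum>j<s. l - card (fixed j)) / real l \<le> real (l * g) / real l"
    using total by (intro divide_right_mono) (simp_all only: of_nat_le_iff of_nat_0_le_iff)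
  also have "\<dots> = real g" using l1 by simp
  finally show ?thesis by simp
qed

text \<open>\<open>site j\<close> is a rotation of the \<open>m\<close> positions and only
  \<open>s \<le> m\<close> indices are used. Distinctness makes the probed letters
  independent.\<close>

lemma distinct_probes: "distinct (probes j)"
proof -
  have "inj_on (site j) {..<m}"
  proof -
    have "a \<le> b" if ab: "a < m" "b < m" "site j a = site j b" for a b
    proof (rule ccontr)
      assume "\<not> a \<le> b"
      then have "m dvd (a + j + l) - (b + j + l)"
        using ab(3) mod_eq_dvd_iff_nat[of "b + j + l" "a + j + l" m] by (simp add: site_def)
      then show False using ab \<open>\<not> a \<le> b\<close> nat_dvd_not_less[of "a - b" m] by simp
    qed
    then show ?thesis by (intro inj_onI order.antisym) auto
  qed
  then have "inj_on (site j) (set (filter (\<lambda>i. code (site j i) \<noteq> \<sigma>) [0..<s]))"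
    using s by (elim inj_on_subset) auto
  then show ?thesis unfolding probes_def by (simp add: distinct_map)
qed

text \<open>Only the last probe can lie in the block: it is \<open>j\<close> itself, needed when distinct letters may
  have the same residue.\<close>

lemma early_probes:
  assumes "j < s" and "r < length (probes j)" and "p \<in> set (take r (probes j))"
  shows "p < j \<or> j + l \<le> p"
proof -
  let ?P = "\<lambda>i. code (site j i) \<noteq> \<sigma>"
  have s': "[0..<s] = [0..<s - 1] @ [s - 1]" using s by (cases s) auto
  have "probes j = map (site j) (filter ?P [0..<s - 1]) @ map (site j) (filter ?P [s - 1])"
    unfolding probes_def s' by simp
  \<comment> \<open>Index \<open>s - 1\<close> contributes at most one entry, at the very end, so a
    proper prefix does not contain it.\<close>
  moreover have "length (map (site j) (filter ?P [s - 1])) \<le> 1" by simp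
  ultimately have "take r (probes j) = take r (map (site j) (filter ?P [0..<s - 1]))"
    using assms(2) by simp
  then have "p \<in> set (map (site j) (filter ?P [0..<s - 1]))"
    using assms(3) in_set_takeD[of p r "map (site j) (filter ?P [0..<s - 1])"] by (simp only:)
  then have "p \<in> site j ` {..<s - 1}" by auto
  then obtain i where i: "i < s - 1" "p = (i + j + l) mod m" by (auto simp: site_def)
  show ?thesis
  proof (cases "i + j + l < m")
    case False
    then have "p = i + j + l - m" using i assms(1) s by (simp add: le_mod_geq)
    then show ?thesis using False i s by linarith
  qed (use i in simp)
qed

text \<open>For a window inside the text and \<open>r\<close> below the number of probes, this says
  that comparison \<open>r\<close>, counted from 0, takes place for a candidate.\<close>

definition event :: "nat list \<Rightarrow> nat \<Rightarrow> nat \<Rightarrow> nat \<Rightarrow> bool" where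
  "event t a j r \<longleftrightarrow> cand (key t a l) j \<and> (\<forall>p\<in>set (take r (probes j)). t ! (p + a - j) = code p)"

text \<open>Block letters and the first \<open>r\<close> probes sit at disjoint text positions,
  hence are independent. A fixed block letter contributes at most \<open>\<rho>\<close>, a probe at
  most \<open>1 / \<sigma> \<le> 1 / 2\<close>. Disjointness is why \<open>r\<close> stays below the
  number of probes: the last one may lie in the block.\<close>

lemma prob_event:
  assumes j: "j < s" and a: "a + l \<le> n"
    and r: "r = 0 \<or> r < length (probes j) \<and> j \<le> a \<and> a + m \<le> n + j"
  shows "measure_pmf.prob (random_text \<sigma> n) {t. event t a j r} \<le> \<rho> ^ card (fixed j) * (1 / 2) ^ r"
proof -
  define D1 where "D1 = (\<lambda>q. a + q) ` fixed j"
  define D2 where "D2 = (\<lambda>p. p + a - j) ` set (take r (probes j))"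
  \<comment> \<open>\<open>q + j - a\<close> translates the text position \<open>q\<close> into a
    pattern position.\<close>
  define B where "B = (\<lambda>q. if q \<in> D1 then {c. c mod M = code (q + j - a) mod M} else {code (q + j - a)})"
  have fin: "finite (fixed j)" by (simp add: fixed_def)
  have sub: "p \<in> set (probes j)" if "p \<in> set (take r (probes j))" for p using that by (rule in_set_takeD)
  have r': "r < length (probes j) \<and> j \<le> a \<and> a + m \<le> n + j" if "p \<in> set (take r (probes j))" for p
    using r that by auto
  have disj: "D1 \<inter> D2 = {}"
  proof (rule ccontr)
    assume "D1 \<inter> D2 \<noteq> {}"
    then obtain q p where q: "q \<in> fixed j" and p: "p \<in> set (take r (probes j))" and eq: "a + q = p + a - j"
      by (auto simp: D1_def D2_def)
    have "p < j \<or> j + l \<le> p" using early_probes[OF j _ p] r'[OF p] by blast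
    then show False using q eq r'[OF p] by (auto simp: fixed_def)
  qed
  have D: "D1 \<union> D2 \<subseteq> {..<n}"
    using a r' sub probes_less by (fastforce simp: D1_def D2_def fixed_def)
  have event: "event t a j r \<longleftrightarrow> (\<forall>q\<in>D1 \<union> D2. t ! q \<in> B q)" for t
  proof -
    have "cand (key t a l) j \<longleftrightarrow> (\<forall>q\<in>fixed j. t ! (a + q) mod M = code (j + q) mod M)"
      unfolding cand_def fixed_def by (auto simp: key_digit)
    also have "\<dots> \<longleftrightarrow> (\<forall>q\<in>D1. t ! q \<in> B q)"
      unfolding B_def D1_def by (auto simp: add.commute)
    finally have 1: "cand (key t a l) j \<longleftrightarrow> (\<forall>q\<in>D1. t ! q \<in> B q)" .
    have "t ! (p + a - j) = code p \<longleftrightarrow> t ! (p + a - j) \<in> B (p + a - j)"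
      if p: "p \<in> set (take r (probes j))" for p
    proof -
      have "p + a - j \<notin> D1" using disj p by (auto simp: D2_def)
      moreover have "p + a - j + j - a = p" using r'[OF p] by simp
      ultimately show ?thesis by (simp add: B_def)
    qed
    then have 2: "(\<forall>p\<in>set (take r (probes j)). t ! (p + a - j) = code p) \<longleftrightarrow> (\<forall>q\<in>D2. t ! q \<in> B q)"
      by (simp add: D2_def)
    show ?thesis unfolding event_def 1 2 by blast
  qed
  have "measure_pmf.prob (random_text \<sigma> n) {t. event t a j r} =
      (\<Prod>q\<in>D1 \<union> D2. real (card ({..<\<sigma>} \<inter> B q)) / real \<sigma>)"
    unfolding event using \<sigma> by (intro prob_random_text D) auto
  also have "\<dots> = (\<Prod>q\<in>D1. real (card ({..<\<sigma>} \<inter> B q)) / real \<sigma>) * (\<Prod>q\<in>D2. real (card ({..<\<sigma>} \<inter> B q)) / real \<sigma>)"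
    using fin disj by (intro prod.union_disjoint) (auto simp: D1_def D2_def)
  also have "\<dots> \<le> (\<Prod>q\<in>D1. \<rho>) * (\<Prod>q\<in>D2. 1 / 2)"
  proof (intro mult_mono prod_mono conjI)
    show "real (card ({..<\<sigma>} \<inter> B q)) / real \<sigma> \<le> \<rho>" if "q \<in> D1" for q
      using that card_residue by (simp add: B_def)
    show "real (card ({..<\<sigma>} \<inter> B q)) / real \<sigma> \<le> 1 / 2" if "q \<in> D2" for q
    proof -
      have "q \<notin> D1" using that disj by blast
      then have "card ({..<\<sigma>} \<inter> B q) \<le> card {code (q + j - a)}"
        unfolding B_def by (intro card_mono) auto
      then show ?thesis using \<sigma> by (simp add: field_simps)
    qed
  qed (use \<rho> in \<open>auto intro!: prod_nonneg\<close>)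
  also have "(\<Prod>q\<in>D1. \<rho>) = \<rho> ^ card (fixed j)"
    by (simp add: D1_def card_image)
  also have "card D2 = r"
  proof -
    have "inj_on (\<lambda>p. p + a - j) (set (take r (probes j)))"
      using r' by (intro inj_onI) (metis add_right_cancel diff_add_inverse2 le_add_diff_inverse2 trans_le_add2)
    then have "card D2 = card (set (take r (probes j)))" unfolding D2_def by (rule card_image)
    also have "\<dots> = length (take r (probes j))"
      by (intro distinct_card distinct_take distinct_probes)
    also have "\<dots> = r" using r by auto
    finally show ?thesis .
  qed
  then have "(\<Prod>q\<in>D2. 1 / 2 :: real) = (1 / 2) ^ r" by simp
  finally show ?thesis .
qed

section \<open>Expected search time\<close>

lemma expectation_candidate:
  assumes j: "j < s" and a: "a + l \<le> n"
  shows "measure_pmf.expectation (random_text \<sigma> n)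
     (\<lambda>t. if cand (key t a l) j then real (30 * work t a j + 110) else 0) \<le> 170 * \<rho> ^ card (fixed j)"
proof -
  let ?E = "measure_pmf.expectation (random_text \<sigma> n)"
  let ?f = "\<lambda>t. if cand (key t a l) j then real (30 * work t a j + 110) else 0"
  define P where "P = (\<lambda>r. measure_pmf.prob (random_text \<sigma> n) {t. event t a j r})"
  \<comment> \<open>Without a valid window nothing is compared, so the sum over \<open>r < N\<close>
    must be empty.\<close>
  define N where "N = (if j \<le> a \<and> a + m \<le> n + j then length (probes j) else 0)"
  have int: "integrable (measure_pmf (random_text \<sigma> n)) f" for f :: "nat list \<Rightarrow> real"
    by (rule integrable_random_text) (use \<sigma> in auto)
  have P: "?E (\<lambda>t. if event t a j r then 1 else 0) = P r" for r
  proof -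
    have "?E (\<lambda>t. if event t a j r then 1 else 0) = ?E (indicator {t. event t a j r})"
      by (intro Bochner_Integration.integral_cong) (auto simp: indicator_def)
    also have "\<dots> = P r" by (simp add: P_def)
    finally show ?thesis .
  qed
  have pt: "?f t \<le> 110 * (if event t a j 0 then 1 else 0) + 30 * (\<Sum>r<N. if event t a j r then 1 else 0)"
    if t: "t \<in> set_pmf (random_text \<sigma> n)" for t
  proof (cases "cand (key t a l) j \<and> valid t a j")
    case True
    have "length t = n" using t \<sigma> by (simp add: set_random_text)
    with True have ja: "j \<le> a" "a + m \<le> n + j" by (auto simp: valid_def)
    then have N: "N = length (probes j)" by (simp add: N_def)
    define h where "h = hits t (a - j) j"
    have h: "h \<le> N" unfolding N h_def hits_def by (rule length_takeWhile_le)
    have ev: "event t a j r" if "r < h" for r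
    proof -
      have "t ! (p + a - j) = code p" if "p \<in> set (take r (probes j))" for p
      proof -
        from that obtain k where k: "k < r" "k < length (probes j)" "p = probes j ! k"
          by (auto simp: in_set_conv_nth)
        then have "t ! (a - j + p) = code p"
          using hits_match[of k t "a - j" j] \<open>r < h\<close> by (simp add: h_def)
        then show ?thesis using ja by (simp add: add.commute)
      qed
      then show ?thesis using True by (simp add: event_def)
    qed
    \<comment> \<open>Successful comparisons are dominated by the events below \<open>N\<close>;
      their probabilities form a geometric series of sum at most 2, so the constant becomes
      \<open>110 + 30 * 2 = 170\<close>.\<close>
    have "real h = (\<Sum>r<h. if event t a j r then 1 else 0)" using ev by simp
    also have "\<dots> \<le> (\<Sum>r<N. if event t a j r then 1 else 0)"
      using h by (intro sum_mono2) auto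
    finally have "real (work t a j) \<le> (\<Sum>r<N. if event t a j r then 1 else 0)"
      using True by (simp add: work_def h_def)
    moreover have "event t a j 0" using True by (simp add: event_def)
    ultimately show ?thesis using True by simp
  next
    case False
    then show ?thesis by (auto simp: work_def event_def intro!: mult_nonneg_nonneg sum_nonneg)
  qed
  have "?E ?f \<le> ?E (\<lambda>t. 110 * (if event t a j 0 then 1 else 0) + 30 * (\<Sum>r<N. if event t a j r then 1 else 0))"
    using pt by (intro integral_mono_AE int) (auto simp: AE_measure_pmf_iff)
  also have "\<dots> = 110 * P 0 + 30 * (\<Sum>r<N. P r)"
    by (simp add: Bochner_Integration.integral_add int Bochner_Integration.integral_sum P)
  also have "\<dots> \<le> 110 * (\<rho> ^ card (fixed j) * (1 / 2) ^ 0) + 30 * (\<Sum>r<N. \<rho> ^ card (fixed j) * (1 / 2) ^ r)"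
    unfolding P_def
    by (intro add_mono mult_left_mono sum_mono prob_event j a) (auto simp: N_def split: if_splits)
  also have "\<dots> = \<rho> ^ card (fixed j) * (110 + 30 * (\<Sum>r<N. (1 / 2) ^ r))"
    by (simp add: sum_distrib_left algebra_simps)
  also have "(\<Sum>r<N. (1 / 2 :: real) ^ r) \<le> 2"
    by (simp add: sum_gp_strict)
  finally show ?thesis using \<rho> by (simp add: mult.commute)
qed

lemma expectation_block:
  assumes a: "a + l \<le> n"
  shows "measure_pmf.expectation (random_text \<sigma> n) (\<lambda>t. real (block_cost t a))
     \<le> 20 * real l + 170 * real g + 440"
proof -
  let ?E = "measure_pmf.expectation (random_text \<sigma> n)"
  have int: "integrable (measure_pmf (random_text \<sigma> n)) f" for f :: "nat list \<Rightarrow> real"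
    by (rule integrable_random_text) (use \<sigma> in auto)
  have eq: "real (block_cost t a) = 20 * real l + 100 +
      (\<Sum>j<s. if cand (key t a l) j then real (30 * work t a j + 110) else 0)" for t
  proof -
    have "{j. j < s \<and> cand (key t a l) j} = {..<s} \<inter> {j. cand (key t a l) j}" by auto
    then show ?thesis by (simp add: block_cost_def sum.If_cases)
  qed
  have "?E (\<lambda>t. real (block_cost t a)) = 20 * real l + 100 +
      (\<Sum>j<s. ?E (\<lambda>t. if cand (key t a l) j then real (30 * work t a j + 110) else 0))"
    unfolding eq by (subst Bochner_Integration.integral_add, rule int, rule int,
        subst Bochner_Integration.integral_sum, rule int) simp
  also have "\<dots> \<le> 20 * real l + 100 + (\<Sum>j<s. 170 * \<rho> ^ card (fixed j))"
    by (intro add_left_mono sum_mono expectation_candidate a) simp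
  also have "\<dots> \<le> 20 * real l + 100 + 170 * (real g + 2)"
    using sum_rho by (simp flip: sum_distrib_left)
  finally show ?thesis by simp
qed

lemma expectation_search:
  assumes n: "m < n"
  shows "measure_pmf.expectation (random_text \<sigma> n) (\<lambda>t. real ((\<Sum>b<blocks n. block_cost t (b * s)) + 20))
     \<le> 2000 * (real n * (real g + max 1 (log (real \<sigma>) (real m))) / real m)"
proof -
  let ?E = "measure_pmf.expectation (random_text \<sigma> n)"
  define X where "X = max 1 (log (real \<sigma>) (real m))"
  define G where "G = real g + X"
  have int: "integrable (measure_pmf (random_text \<sigma> n)) f" for f :: "nat list \<Rightarrow> real"
    by (rule integrable_random_text) (use \<sigma> in auto)
  have "1 \<le> X" "log (real \<sigma>) (real m) \<le> X" "0 \<le> real g" by (auto simp: X_def)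
  note X = this l_log
  \<comment> \<open>\<open>X \<ge> 1\<close> absorbs the constants, including the one in
    \<open>l \<le> 1 + X\<close>.\<close>
  have G: "20 * real l + 170 * real g + 440 \<le> 480 * G"
    using X unfolding G_def distrib_left by linarith
  have G1: "1 \<le> G" using X unfolding G_def by linarith
  have nm: "1 \<le> real n / real m" using n m by simp
  \<comment> \<open>With \<open>s \<ge> m / 2\<close> there are at most \<open>2 * n / m + 1\<close>
    blocks, and \<open>n / m \<ge> 1\<close> absorbs the summand 1.\<close>
  have "real (blocks n) \<le> real (n - l) / real s + 1"
    unfolding blocks_def using of_nat_div_le_of_nat[of "n - l" s] by simp
  also have "real (n - l) / real s \<le> real n / (real m / 2)"
    using s m by (intro frac_le) auto
  finally have bl: "real (blocks n) \<le> 3 * (real n / real m)" using nm by simp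
  have "?E (\<lambda>t. real ((\<Sum>b<blocks n. block_cost t (b * s)) + 20)) =
      (\<Sum>b<blocks n. ?E (\<lambda>t. real (block_cost t (b * s)))) + 20"
    by (simp add: Bochner_Integration.integral_add int Bochner_Integration.integral_sum)
  also have "\<dots> \<le> (\<Sum>b<blocks n. 480 * G) + 20"
    using G blocks[of n] l_le n
    by (intro add_right_mono sum_mono order_trans[OF expectation_block]) auto
  also have "\<dots> = real (blocks n) * (480 * G) + 20" by simp
  also have "\<dots> \<le> 3 * (real n / real m) * (480 * G) + 20 * ((real n / real m) * G)"
    using bl G1 nm mult_mono[OF nm G1] by (intro add_mono mult_right_mono) auto
  also have "\<dots> = 1460 * ((real n / real m) * G)" by simp
  also have "\<dots> \<le> 2000 * ((real n / real m) * G)" using G1 by (intro mult_right_mono) auto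
  finally show ?thesis by (simp add: G_def X_def)
qed

end

section \<open>Word size and assembly of the result\<close>

lemma power_le_word:
  assumes "real 8 * log 2 (real k) \<le> real w" and "k \<ge> 1"
  shows "k ^ 8 \<le> 2 ^ w"
proof -
  have "log 2 (real (k ^ 8)) \<le> real w"
    using assms by (simp add: log_nat_power)
  then have "real (k ^ 8) \<le> 2 powr real w"
    using assms by (subst (asm) log_le_iff) auto
  also have "\<dots> = real (2 ^ w)" by (simp add: powr_realpow)
  finally show ?thesis by (rule of_nat_le_iff[THEN iffD1])
qed

theorem theorem7:
  shows "\<exists>(preprocess :: com) (search :: com) (C :: nat) (\<kappa> :: nat).
    \<forall>(\<sigma> :: nat) (m :: nat) (g :: nat) (x :: nat option list) (w :: nat).
      \<sigma> \<ge> 2 \<longrightarrow> m \<ge> 1 \<longrightarrow>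
      length x = m \<longrightarrow> set x \<subseteq> insert None (Some ` {..<\<sigma>}) \<longrightarrow> count_list x None = g \<longrightarrow>
      real g / real m < 1 / 2 - 3 * log (real \<sigma>) (real m) / real m \<longrightarrow>
      \<sigma> < 2 ^ w \<longrightarrow> real \<kappa> * log 2 (real (m + 1)) \<le> real w \<longrightarrow>
      (\<exists>k s.
         exec (C * m ^ 4) w [] preprocess (pattern_start \<sigma> x) k s \<and> k \<le> C * m ^ 4 \<and>
         (\<forall>n :: nat. n > m \<longrightarrow> real \<kappa> * log 2 (real n) \<le> real w \<longrightarrow>
           (\<exists>T :: nat list \<Rightarrow> nat.
              (\<forall>t. length t = n \<longrightarrow> set t \<subseteq> {..<\<sigma>} \<longrightarrow>
                 (\<exists>s'. exec (C * m ^ 4) w t search (search_start n s) (T t) s' \<and>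
                       set (out s') = occurrences x t)) \<and>
              measure_pmf.expectation (random_text \<sigma> n) (\<lambda>t. real (T t))
                \<le> real C * (real n * (real g + max 1 (log (real \<sigma>) (real m))) / real m))))"
proof (rule exI[of _ preprocess], rule exI[of _ search], rule exI[of _ 2000], rule exI[of _ 8],
    intro allI impI, goal_cases)
  \<comment> \<open>The constant 2000 covers the memory (\<open>6 * m ^ 4\<close>), the
    preprocessing time (\<open>1000 * m ^ 4\<close>) and the search time. The factor 8 bounds
    \<open>(m + 1) ^ 8\<close> and \<open>n ^ 8\<close> by \<open>2 ^ w\<close>, which rules out
    overflow.\<close>
  case (1 \<sigma> m g x w)
  have "wildcard_pattern \<sigma> m g x w"
    using 1 power_le_word[of "m + 1" w] by unfold_locales simp_all
  then interpret wildcard_pattern \<sigma> m g x w .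
  have S: "6 * m ^ 4 \<le> 2000 * m ^ 4" by simp
  obtain k st where pre: "exec (2000 * m ^ 4) w [] preprocess (pattern_start \<sigma> x) k st"
    "k \<le> 1000 * m ^ 4" "ready 0 st"
    using preprocess_correct[OF S] unfolding wp_def by blast
  show ?case
  proof (intro exI[of _ k] exI[of _ st] conjI allI impI)
    fix n :: nat assume n: "n > m" "real 8 * log 2 (real n) \<le> real w"
    let ?s = "search_start n st"
    let ?run = "\<lambda>t k s'. exec (2000 * m ^ 4) w t search ?s k s' \<and>
       k \<le> (\<Sum>b<blocks n. block_cost t (b * s)) + 20 \<and> set (out s') = occurrences x t"
    have ready: "ready n ?s"
      using pre(3) by (auto simp: ready_def search_start_def env_def R_def)
    have run: "\<exists>k s'. ?run t k s'" if t: "length t = n" "set t \<subseteq> {..<\<sigma>}" for t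
    proof -
      have "wp (2000 * m ^ 4) w t search (\<lambda>k st'. k \<le> (\<Sum>b<blocks n. block_cost t (b * s)) + 20 \<and>
          set (out st') = (\<Union>b<blocks n. block_out t (b * s))) ?s"
      proof (rule wp_search[OF S t(1) n(1) _ ready])
        show "n ^ 8 \<le> 2 ^ w" using n by (intro power_le_word) auto
      qed (simp add: search_start_def)
      then show ?thesis
        using block_out_correct[OF t(2)] t(1) n(1) unfolding wp_def by auto
    qed
    \<comment> \<open>On lists that are not texts of length \<open>n\<close> the choice is
      arbitrary; they lie outside the support and do not affect the expectation.\<close>
    define T where "T t = (SOME k. \<exists>s'. ?run t k s')" for t
    have T: "\<exists>s'. ?run t (T t) s'" if "length t = n" "set t \<subseteq> {..<\<sigma>}" for t
      unfolding T_def using run[OF that] by (rule someI_ex)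
    show "\<exists>T :: nat list \<Rightarrow> nat.
        (\<forall>t. length t = n \<longrightarrow> set t \<subseteq> {..<\<sigma>} \<longrightarrow>
           (\<exists>s'. exec (2000 * m ^ 4) w t search ?s (T t) s' \<and> set (out s') = occurrences x t)) \<and>
        measure_pmf.expectation (random_text \<sigma> n) (\<lambda>t. real (T t))
          \<le> real 2000 * (real n * (real g + max 1 (log (real \<sigma>) (real m))) / real m)"
    proof (intro exI[of _ T] conjI allI impI)
      fix t :: "nat list" assume "length t = n" "set t \<subseteq> {..<\<sigma>}"
      then show "\<exists>s'. exec (2000 * m ^ 4) w t search ?s (T t) s' \<and> set (out s') = occurrences x t"
        using T by blast
    next
      have \<sigma>0: "\<sigma> > 0" using \<sigma> by simp
      have "measure_pmf.expectation (random_text \<sigma> n) (\<lambda>t. real (T t)) \<le>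
          measure_pmf.expectation (random_text \<sigma> n) (\<lambda>t. real ((\<Sum>b<blocks n. block_cost t (b * s)) + 20))"
      proof (intro integral_mono_AE integrable_random_text \<sigma>0)
        show "AE t in measure_pmf (random_text \<sigma> n).
            real (T t) \<le> real ((\<Sum>b<blocks n. block_cost t (b * s)) + 20)"
          unfolding AE_measure_pmf_iff set_random_text[OF \<sigma>0] using T by (auto simp only: of_nat_le_iff)
      qed
      also note expectation_search[OF n(1)]
      finally show "measure_pmf.expectation (random_text \<sigma> n) (\<lambda>t. real (T t))
          \<le> real 2000 * (real n * (real g + max 1 (log (real \<sigma>) (real m))) / real m)" by simp
    qed
  qed (use pre in auto)
qed

end
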